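(* Let $n\ge2$, $k\ge1$, $N\geq 1$ be integers and let $h(t)=g(t^2)$, $t\in[-1,1]$, where $g:[0,1]\to(-\infty,\infty]$ is finite and continuous on $[0,1)$, continuous in the extended sense at $1$ (i.e. $\lim_{u\to1^-}g(u)=g(1)$, where $g(1)=+\infty$ is allowed), and $(k+1)$-times differentiable in $(0,1)$. Assume there exists a spherical $(k,k)$-design $C\subset\mathbb S^{n-1}$ of cardinality $N$, let $R_{k,N}<s<1$, and suppose that $g^{(k+1)}(u)\ge0$ on $(0,s^2)$. Then $$m^h(C)\ \le\ m_N^h(k)\ \le\ N\sum_{i=0}^{k+1}\theta_i\,h(\lambda_i),$$ where $-\lambda_0=\lambda_{k+1}=s$, $\lambda_1<\dots<\lambda_k$ are the zeros of the polynomial $q_{k,s}$ of degree $k$ that is orthogonal to all polynomials of lower degree with respect to the signed measure $d\nu_s(t)=\gamma_n(s^2-t^2)(1-t^2)^{(n-3)/2}\,dt$ on $[-1,1]$, and $\theta_i$ are the associated weights (defined in the context).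
   Context: $\mathbb S^{n-1}$ is the unit sphere in $\mathbb R^n$; a spherical code is a finite nonempty set $C=\{x_1,\dots,x_N\}\subset\mathbb S^{n-1}$, $|C|=N$. Gegenbauer polynomials: $d\mu_n(t)=\gamma_n(1-t^2)^{(n-3)/2}\,dt$ on $[-1,1]$, where $\gamma_n$ is such that $\mu_n$ is a probability measure; $P_\ell^{(n)}$, $\ell\ge0$, are the polynomials with $\deg P_\ell^{(n)}=\ell$, pairwise orthogonal with respect to $\mu_n$, normalized by $P_\ell^{(n)}(1)=1$. A spherical code $C=\{x_1,\dots,x_N\}$ is a spherical $(k,k)$-design if $\sum_{i,j=1}^N P_\ell^{(n)}(x_i\cdot x_j)=0$ for every even $\ell=2,4,\dots,2k$. Potentials: $U^h(x,C)=\sum_{i=1}^N h(x\cdot x_i)$ for $x\in\mathbb S^{n-1}$ (with $t+\infty=\infty$ for $t\in\mathbb R\cup\{+\infty\}$); $m^h(C)=\inf_{x\in\mathbb S^{n-1}}U^h(x,C)$; $m_N^h(k)=\sup\{m^h(C): C\subset\mathbb S^{n-1}\text{ is a }(k,k)\text{-design},\ |C|=N\}$. For a code $C$, $r(C)=\min_{x\in\mathbb S^{n-1}}\max\{x\cdot y: y\in C\cup(-C)\}$, and $R_{k,N}=\sup\{r(C): C\subset\mathbb S^{n-1}\text{ is a }(k,k)\text{-design},\ |C|=N\}$. Under the assumption $s>R_{k,N}$, the polynomial $q_{k,s}$ exists, is unique up to a nonzero constant factor, and has $k$ real simple zeros $\lambda_1<\dots<\lambda_k$ in $(-s,s)$.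 The weights are $\theta_i=\int_{-1}^1\ell_i\,d\mu_n$, $i=0,\dots,k+1$, where $\ell_i$ are the fundamental Lagrange polynomials (of degree $k+1$) for the nodes $\lambda_0,\dots,\lambda_{k+1}$, i.e. $\ell_i(\lambda_j)=1$ if $i=j$ and $0$ otherwise. *)

theory Defs
  imports "HOL-Analysis.Analysis" "HOL-Computational_Algebra.Polynomial"
begin

subsection \<open>Gegenbauer polynomials\<close>

text \<open>The dimension enters the one-dimensional objects as a natural number \<open>n\<close>; it is
  instantiated with \<open>CARD('n)\<close> for codes in \<open>real ^ 'n\<close>. The convention \<open>0 powr a = 0\<close> only
  affects the weight at the null set \<open>{-1, 1}\<close>.\<close>

definition gegenbauer_const :: "nat \<Rightarrow> real" where
  "gegenbauer_const n = 1 / (LINT t:{-1..1}|lborel. (1 - t\<^sup>2) powr ((real n - 3) / 2))"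

definition gegenbauer_weight :: "nat \<Rightarrow> real \<Rightarrow> real" where
  "gegenbauer_weight n t = gegenbauer_const n * (1 - t\<^sup>2) powr ((real n - 3) / 2)"

definition gegenbauer_measure :: "nat \<Rightarrow> real measure" where
  "gegenbauer_measure n =
     density lborel (\<lambda>t. ennreal (indicator {-1..1} t * gegenbauer_weight n t))"

definition gegenbauer_poly :: "nat \<Rightarrow> nat \<Rightarrow> real poly" where
  "gegenbauer_poly n = (THE P.
     (\<forall>l. degree (P l) = l \<and> poly (P l) 1 = 1) \<and>
     (\<forall>l m. l \<noteq> m \<longrightarrow> (LINT t|gegenbauer_measure n. poly (P l) t * poly (P m) t) = 0))"


subsection \<open>Spherical codes and designs\<close>

definition spherical_code :: "(real ^ 'n) set \<Rightarrow> bool" where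
  "spherical_code C \<longleftrightarrow> finite C \<and> C \<noteq> {} \<and> C \<subseteq> sphere 0 1"

definition kk_design :: "nat \<Rightarrow> (real ^ 'n) set \<Rightarrow> bool" where
  "kk_design k C \<longleftrightarrow> spherical_code C \<and>
     (\<forall>l\<in>{2..2 * k}. even l \<longrightarrow>
        (\<Sum>x\<in>C. \<Sum>y\<in>C. poly (gegenbauer_poly CARD('n) l) (x \<bullet> y)) = 0)"

definition kk_designs :: "nat \<Rightarrow> nat \<Rightarrow> (real ^ 'n) set set" where
  "kk_designs k N = {C. kk_design k C \<and> card C = N}"


subsection \<open>Potentials and covering\<close>

definition potential :: "(real \<Rightarrow> ereal) \<Rightarrow> real ^ 'n \<Rightarrow> (real ^ 'n) set \<Rightarrow> ereal" where
  "potential h x C = (\<Sum>y\<in>C. h (x \<bullet> y))"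

definition min_potential :: "(real \<Rightarrow> ereal) \<Rightarrow> (real ^ 'n) set \<Rightarrow> ereal" where
  "min_potential h C = (INF x\<in>sphere 0 1. potential h x C)"

definition maxmin_potential :: "'n::finite itself \<Rightarrow> (real \<Rightarrow> ereal) \<Rightarrow> nat \<Rightarrow> nat \<Rightarrow> ereal" where
  "maxmin_potential _ h k N = (SUP C\<in>(kk_designs k N :: (real ^ 'n) set set). min_potential h C)"

text \<open>The infimum over the compact sphere is a minimum, the maximum being continuous in \<open>x\<close>.\<close>

definition covering_cos :: "(real ^ 'n) set \<Rightarrow> real" where
  "covering_cos C = (INF x\<in>sphere 0 1. Max ((\<lambda>y. x \<bullet> y) ` (C \<union> uminus ` C)))"

text \<open>A supremum of reals: it has its usual meaning as soon as a \<open>(k,k)\<close>-design with \<open>N\<close> points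
  exists, all values \<^term>\<open>covering_cos C\<close> being at most 1.\<close>

definition max_covering_cos :: "'n::finite itself \<Rightarrow> nat \<Rightarrow> nat \<Rightarrow> real" where
  "max_covering_cos _ k N = (SUP C\<in>(kk_designs k N :: (real ^ 'n) set set). covering_cos C)"


subsection \<open>The quadrature rule\<close>

text \<open>Integration against the signed measure
  \<open>d\<nu>\<^sub>s = \<gamma>\<^sub>n (s\<^sup>2 - t\<^sup>2) (1 - t\<^sup>2)\<^bsup>(n-3)/2\<^esup> dt\<close> on \<open>[-1, 1]\<close>, which changes sign at \<open>t = \<plusminus>s\<close>.\<close>

definition nu_integral :: "nat \<Rightarrow> real \<Rightarrow> (real \<Rightarrow> real) \<Rightarrow> real" where
  "nu_integral n s f = (LINT t:{-1..1}|lborel. f t * ((s\<^sup>2 - t\<^sup>2) * gegenbauer_weight n t))"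

definition is_q_poly :: "nat \<Rightarrow> nat \<Rightarrow> real \<Rightarrow> real poly \<Rightarrow> bool" where
  "is_q_poly n k s q \<longleftrightarrow> q \<noteq> 0 \<and> degree q = k \<and>
     (\<forall>p. degree p < k \<longrightarrow> nu_integral n s (\<lambda>t. poly q t * poly p t) = 0)"

text \<open>\<open>q\<close> is determined only up to a nonzero factor; its zeros do not depend on the choice.\<close>

definition q_poly :: "nat \<Rightarrow> nat \<Rightarrow> real \<Rightarrow> real poly" where
  "q_poly n k s = (SOME q. is_q_poly n k s q)"

text \<open>The list of zeros is indexed from 0, the inner nodes from 1.\<close>

definition node :: "nat \<Rightarrow> nat \<Rightarrow> real \<Rightarrow> nat \<Rightarrow> real" where
  "node n k s i =
     (if i = 0 then - s
      else if i \<le> k then sorted_list_of_set {t. poly (q_poly n k s) t = 0} ! (i - 1)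
      else s)"

definition lagrange_poly :: "nat \<Rightarrow> (nat \<Rightarrow> real) \<Rightarrow> nat \<Rightarrow> real poly" where
  "lagrange_poly m z i = (THE p. degree p = m \<and>
     (\<forall>j\<le>m. poly p (z j) = (if i = j then 1 else 0)))"

definition quad_weight :: "nat \<Rightarrow> nat \<Rightarrow> real \<Rightarrow> nat \<Rightarrow> real" where
  "quad_weight n k s i =
     (LINT t|gegenbauer_measure n. poly (lagrange_poly (k + 1) (node n k s) i) t)"

end

theory Submission imports Defs begin

text \<open>
  Two facts combine. On the one hand, a \<open>(k,k)\<close>-design \<open>D\<close> with \<open>N\<close> points averages every
  polynomial \<open>f\<close> of degree at most \<open>2k+1\<close> correctly after symmetrization: for every unit vector
  \<open>x\<close>, the sum of \<open>f (x \<bullet> y) + f (- (x \<bullet> y))\<close> over \<open>y \<in> D\<close> is \<open>2 N\<close> times the integral of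
  \<open>f\<close> against the Gegenbauer measure (\<open>design_cubature\<close>). On the other hand, that integral is given
  exactly by the quadrature rule with nodes \<open>\<lambda>\<^sub>i\<close> and weights \<open>\<theta>\<^sub>i\<close> (\<open>quadrature\<close>). So let \<open>f\<close> be
  an even polynomial of degree at most \<open>2k\<close> with \<open>h \<le> f\<close> on \<open>[-s, s]\<close> and \<open>f = h\<close> at the nodes.
  Since \<open>s\<close> exceeds the covering cosine of \<open>D\<close>, there is a unit vector \<open>x\<close> with all
  \<open>\<bar>x \<bullet> y\<bar> < s\<close>; there the potential of \<open>h\<close> is at most that of \<open>f\<close>, which equals
  \<open>N \<Sum> \<theta>\<^sub>i f (\<lambda>\<^sub>i) = N \<Sum> \<theta>\<^sub>i h (\<lambda>\<^sub>i)\<close>.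

  \<^emph>\<open>The majorant.\<close> Put \<open>u = t\<^sup>2\<close>. The nodes are symmetric about \<open>0\<close>, so Hermite interpolation of
  \<open>g\<close>, double at the squares of the positive inner nodes, simple at \<open>s\<^sup>2\<close>, and simple at \<open>0\<close> if
  \<open>0\<close> is a node, amounts to \<open>k + 1\<close> conditions and is solved by a polynomial of degree at most
  \<open>k\<close>. The error is \<open>g\<^bsup>(k+1)\<^esup>(\<xi>) / (k+1)!\<close> times a nodal polynomial which is nonpositive on
  \<open>[0, s\<^sup>2]\<close> (\<open>hermite_interpolant_upper_bound\<close>).

  \<^emph>\<open>The nodes.\<close> Although \<open>\<nu>\<^sub>s\<close> is a signed measure, the cubature property of a design, evaluated
  at the above \<open>x\<close>, shows that on polynomials of degree below \<open>2k\<close> it acts as a positive discrete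
  measure carried by the points \<open>\<plusminus> (x \<bullet> y)\<close> of \<open>(-s, s)\<close> (\<open>nu_functional_pos\<close>). The classical
  theory of orthogonal polynomials therefore applies and yields \<open>k\<close> simple zeros in \<open>(-s, s)\<close>,
  symmetric about \<open>0\<close> (\<open>q_poly_roots\<close>).

  \<^emph>\<open>The cubature property.\<close> The design equations say that pairs of points of the design average
  each even power \<open>(x \<bullet> y)\<^bsup>2j\<^esup>\<close>, \<open>j \<le> k\<close>, to the moment \<open>c\<^sub>j\<close> of the Gegenbauer measure.
  By the argument for the equality case of Sidelnikov's inequality this already determines the
  average over one point (\<open>sidelnikov_equality\<close>): the kernel \<open>(x \<bullet> y)\<^bsup>2j\<^esup>\<close> is positive
  semidefinite, the form \<open>(z \<bullet> z)\<^sup>j\<close> is a linear combination \<open>\<Sum> a\<^sub>i (w\<^sub>i \<bullet> z)\<^bsup>2j\<^esup>\<close>, and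
  the signed combination \<open>\<Sum>\<^bsub>y\<in>D\<^esub> \<delta>(y) - N c\<^sub>j \<Sum> a\<^sub>i \<delta>(w\<^sub>i)\<close> has energy zero.
  So its potential vanishes identically, which is the claim.
\<close>

section \<open>Interpolation and Rolle\<close>

lemma lagrange_fundamental_poly:
  fixes S :: "real set"
  assumes "finite S" "x \<in> S"
  shows "\<exists>p. degree p = card S - 1 \<and> (\<forall>y\<in>S. poly p y = (if y = x then 1 else 0))"
proof -
  define r where "r = (\<Prod>y\<in>S - {x}. [:- y, 1:])"
  have deg: "degree r = card S - 1"
    unfolding r_def using assms by (subst degree_prod_eq_sum_degree) auto
  have ev: "poly r z = (\<Prod>y\<in>S - {x}. z - y)" for z
    unfolding r_def by (simp add: poly_prod)
  have nz: "poly r x \<noteq> 0"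
    unfolding ev using assms by (auto simp: prod_zero_iff)
  have "poly r y = 0" if "y \<in> S" "y \<noteq> x" for y
    unfolding ev using assms that by (auto simp: prod_zero_iff)
  then have "degree (smult (1 / poly r x) r) = card S - 1 \<and>
      (\<forall>y\<in>S. poly (smult (1 / poly r x) r) y = (if y = x then 1 else 0))"
    using deg nz by auto
  then show ?thesis by blast
qed

lemma lagrange_expansion:
  fixes z :: "'i \<Rightarrow> real"
  assumes I: "finite I" "inj_on z I" and p: "degree p < card I"
    and l: "\<And>i. i \<in> I \<Longrightarrow> degree (l i) = card I - 1"
      "\<And>i j. i \<in> I \<Longrightarrow> j \<in> I \<Longrightarrow> poly (l i) (z j) = (if i = j then 1 else 0)"
  shows "p = (\<Sum>i\<in>I. smult (poly p (z i)) (l i))"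
proof (rule poly_eqI_degree[of "z ` I"])
  have card: "card (z ` I) = card I" using I(2) by (rule card_image)
  have "degree (\<Sum>i\<in>I. smult (poly p (z i)) (l i)) \<le> card I - 1"
    by (intro degree_sum_le I(1)) (simp add: l(1))
  then show "degree (\<Sum>i\<in>I. smult (poly p (z i)) (l i)) < card (z ` I)"
    using p card by simp
  show "degree p < card (z ` I)" using p card by simp
  fix x assume "x \<in> z ` I"
  then obtain j where j: "j \<in> I" "x = z j" by blast
  have "poly (\<Sum>i\<in>I. smult (poly p (z i)) (l i)) x = (\<Sum>i\<in>I. if i = j then poly p (z i) else 0)"
    unfolding poly_sum by (rule sum.cong) (auto simp: l(2) j)
  then show "poly p x = poly (\<Sum>i\<in>I. smult (poly p (z i)) (l i)) x" using j I(1) by simp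
qed

lemma lagrange_interpolation:
  fixes S :: "real set"
  assumes "finite S" "S \<noteq> {}"
  shows "\<exists>p. degree p < card S \<and> (\<forall>x\<in>S. poly p x = f x)"
proof -
  have "\<forall>x\<in>S. \<exists>p. degree p = card S - 1 \<and> (\<forall>y\<in>S. poly p y = (if y = x then 1 else 0))"
    using lagrange_fundamental_poly[OF assms(1)] by blast
  then obtain l where l: "\<And>x. x \<in> S \<Longrightarrow> degree (l x) = card S - 1"
    "\<And>x y. x \<in> S \<Longrightarrow> y \<in> S \<Longrightarrow> poly (l x) y = (if y = x then 1 else 0)"
    by metis
  define p where "p = (\<Sum>x\<in>S. smult (f x) (l x))"
  have "degree p \<le> card S - 1"
    unfolding p_def by (intro degree_sum_le assms(1)) (simp add: l(1))
  moreover have "card S > 0" using assms by (simp add: card_gt_0_iff)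
  moreover have "poly p y = f y" if "y \<in> S" for y
  proof -
    have "poly p y = (\<Sum>x\<in>S. if y = x then f x else 0)"
      unfolding p_def poly_sum by (rule sum.cong) (auto simp: l(2) that)
    then show ?thesis using that assms(1) by simp
  qed
  ultimately show ?thesis by (intro exI[of _ p]) auto
qed

text \<open>Correct the Lagrange interpolant \<open>p\<close> by \<open>w m\<close>, where \<open>w\<close> is the nodal polynomial of \<open>S\<close>: this
  leaves the values alone and changes the derivative at \<open>x \<in> S\<close> by \<open>w' x m x\<close>, with \<open>w' x \<noteq> 0\<close>,
  so the values of \<open>m\<close> on \<open>D\<close> can be chosen by a second Lagrange interpolation.\<close>
lemma hermite_interpolation:
  fixes S D :: "real set"
  assumes "finite S" "S \<noteq> {}" "finite D" "D \<subseteq> S"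
  shows "\<exists>p. degree p < card S + card D \<and> (\<forall>x\<in>S. poly p x = f x) \<and>
             (\<forall>x\<in>D. poly (pderiv p) x = f' x)"
proof (cases "D = {}")
  case True
  then show ?thesis using lagrange_interpolation[OF assms(1,2), of f] by auto
next
  case False
  obtain p where p: "degree p < card S" "\<forall>x\<in>S. poly p x = f x"
    using lagrange_interpolation[OF assms(1,2), of f] by blast
  define w where "w = (\<Prod>y\<in>S. [:- y, 1:])"
  have w0: "poly w x = 0" if "x \<in> S" for x
    unfolding w_def using assms that by (auto simp: poly_prod prod_zero_iff)
  have degw: "degree w = card S"
    unfolding w_def by (subst degree_prod_eq_sum_degree) auto
  have w1: "poly (pderiv w) x \<noteq> 0" if "x \<in> S" for x
  proof -
    define v where "v = (\<Prod>y\<in>S - {x}. [:- y, 1:])"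
    have "w = [:- x, 1:] * v"
      unfolding w_def v_def using assms that by (subst prod.remove[of _ x]) auto
    then have "pderiv w = v + [:- x, 1:] * pderiv v"
      by (simp add: pderiv_mult pderiv_pCons del: mult_pCons_left)
    then have "poly (pderiv w) x = poly v x" by simp
    also have "\<dots> \<noteq> 0" unfolding v_def using assms by (auto simp: poly_prod prod_zero_iff)
    finally show ?thesis .
  qed
  obtain m where m: "degree m < card D"
    "\<forall>x\<in>D. poly m x = (f' x - poly (pderiv p) x) / poly (pderiv w) x"
    using lagrange_interpolation[OF assms(3) False,
        of "\<lambda>x. (f' x - poly (pderiv p) x) / poly (pderiv w) x"] by blast
  have "degree (w * m) < card S + card D"
    using degree_mult_le[of w m] degw m(1) by linarith
  then have "degree (p + w * m) < card S + card D"
    using p(1) by (intro degree_add_less) auto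
  moreover have "\<forall>x\<in>S. poly (p + w * m) x = f x" using p w0 by simp
  moreover have "\<forall>x\<in>D. poly (pderiv (p + w * m)) x = f' x"
    using w0 w1 m(2) assms(4) by (auto simp: pderiv_add pderiv_mult)
  ultimately show ?thesis by blast
qed

text \<open>The new zeros lie strictly between the old ones; being disjoint from them is what allows double
  zeros of \<open>f\<close> to be counted in addition. The last conjunct keeps the induction going: the zeros
  obtained from \<open>Z\<close> without its maximum stay below the gap in front of that maximum.\<close>
lemma Rolle_finite_zeros:
  fixes f f' :: "real \<Rightarrow> real"
  assumes "continuous_on {a..b} f"
    and "\<And>x. x \<in> {a<..<b} \<Longrightarrow> (f has_real_derivative f' x) (at x)"
    and "finite Z" "Z \<subseteq> {a..b}" "\<And>z. z \<in> Z \<Longrightarrow> f z = 0" "card Z = Suc m"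
  shows "\<exists>Z'. finite Z' \<and> card Z' = m \<and> Z' \<subseteq> {a<..<b} - Z \<and>
              (\<forall>z\<in>Z'. f' z = 0) \<and> (\<forall>z\<in>Z'. z < Max Z)"
  using assms(3-6)
proof (induction m arbitrary: Z)
  case 0
  then show ?case by (intro exI[of _ "{}"]) auto
next
  case (Suc m)
  define M where "M = Max Z"
  define Y where "Y = Z - {M}"
  have ne: "Z \<noteq> {}" using Suc.prems by auto
  have MZ: "M \<in> Z" unfolding M_def using Suc.prems(1) ne by (rule Max_in)
  have cY: "card Y = Suc m" unfolding Y_def using MZ Suc.prems by simp
  have finY: "finite Y" unfolding Y_def using Suc.prems by simp
  obtain Z' where Z': "finite Z'" "card Z' = m" "Z' \<subseteq> {a<..<b} - Y" "\<forall>z\<in>Z'. f' z = 0"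
     "\<forall>z\<in>Z'. z < Max Y"
    using Suc.IH[of Y] Suc.prems finY cY unfolding Y_def by auto
  have Yne: "Y \<noteq> {}" using cY by auto
  define L where "L = Max Y"
  have LY: "L \<in> Y" unfolding L_def using finY Yne by (rule Max_in)
  have lt: "L < M"
    using LY Suc.prems(1) Max_ge[of Z L] unfolding Y_def M_def by (auto simp: less_le)
  have ab: "a \<le> L" "M \<le> b" using LY MZ Suc.prems(2) unfolding Y_def by auto
  have "\<exists>z. L < z \<and> z < M \<and> f' z = 0"
  proof -
    have "\<exists>z>L. z < M \<and> (\<lambda>h. f' z * h) = (\<lambda>v. 0)"
    proof (rule Rolle_deriv[OF lt])
      show "f L = f M" using Suc.prems(3) LY MZ unfolding Y_def by auto
      show "continuous_on {L..M} f"
        using assms(1) ab by (auto intro: continuous_on_subset)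
      show "(f has_derivative (\<lambda>h. f' x * h)) (at x)" if "L < x" "x < M" for x
        using assms(2)[of x] ab that by (simp add: has_field_derivative_def)
    qed
    then show ?thesis by (metis mult.right_neutral)
  qed
  then obtain z where z: "L < z" "z < M" "f' z = 0" by blast
  have zY: "y \<le> L" if "y \<in> Y" for y unfolding L_def using finY that by auto
  have "z \<notin> Z'" using Z'(5) z unfolding L_def by auto
  moreover have "z \<notin> Z" using zY[of z] z unfolding Y_def by auto
  moreover have "M \<notin> Z'" using Z'(5) lt unfolding L_def by auto
  ultimately show ?case
    using Z' z ab lt unfolding M_def[symmetric] L_def[symmetric]
    by (intro exI[of _ "insert z Z'"]) (auto simp: Y_def)
qed

text \<open>\<open>F j\<close> stands for the \<open>j\<close>-th derivative of \<open>F 0\<close>.\<close>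
lemma iterated_Rolle:
  fixes F :: "nat \<Rightarrow> real \<Rightarrow> real"
  assumes "\<And>j x. j < m \<Longrightarrow> x \<in> {a<..<b} \<Longrightarrow> (F j has_real_derivative F (Suc j) x) (at x)"
    and "finite Z" "Z \<subseteq> {a<..<b}" "\<And>z. z \<in> Z \<Longrightarrow> F 0 z = 0" "card Z = Suc m"
  shows "\<exists>z\<in>{a<..<b}. F m z = 0"
  using assms
proof (induction m arbitrary: F Z)
  case 0
  then have "Z \<noteq> {}" by auto
  with 0 show ?case by blast
next
  case (Suc m)
  have ne: "Z \<noteq> {}" using Suc.prems by auto
  have sub: "{Min Z..Max Z} \<subseteq> {a<..<b}"
  proof -
    have "Min Z \<in> Z" "Max Z \<in> Z" using ne Suc.prems(2) by auto
    then have "a < Min Z" "Max Z < b" using Suc.prems(3) by auto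
    then show ?thesis by auto
  qed
  have "\<exists>Z'. finite Z' \<and> card Z' = Suc m \<and> Z' \<subseteq> {Min Z<..<Max Z} - Z \<and>
              (\<forall>z\<in>Z'. F (Suc 0) z = 0) \<and> (\<forall>z\<in>Z'. z < Max Z)"
  proof (rule Rolle_finite_zeros[where f = "F 0"])
    show der: "(F 0 has_real_derivative F (Suc 0) x) (at x)" if "x \<in> {Min Z<..<Max Z}" for x
      using that subsetD[OF sub, of x] by (intro Suc.prems(1)) auto
    show "continuous_on {Min Z..Max Z} (F 0)"
    proof (rule continuous_at_imp_continuous_on, rule ballI)
      fix x assume "x \<in> {Min Z..Max Z}"
      then have "(F 0 has_real_derivative F (Suc 0) x) (at x)" using sub Suc.prems(1) by blast
      then show "isCont (F 0) x" by (rule DERIV_isCont)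
    qed
    show "Z \<subseteq> {Min Z..Max Z}" using Suc.prems(2) by auto
  qed (use Suc.prems in auto)
  then obtain Z' where Z': "finite Z'" "card Z' = Suc m" "Z' \<subseteq> {Min Z<..<Max Z} - Z"
    "\<forall>z\<in>Z'. F (Suc 0) z = 0" by blast
  have "\<exists>z\<in>{a<..<b}. F (Suc m) z = 0"
  proof (rule Suc.IH[where F = "\<lambda>j. F (Suc j)" and Z = Z'])
    show "(F (Suc j) has_real_derivative F (Suc (Suc j)) x) (at x)"
      if "j < m" "x \<in> {a<..<b}" for j x using Suc.prems(1) that by simp
    show "Z' \<subseteq> {a<..<b}" using Z'(3) sub by fastforce
  qed (use Z' in auto)
  then show ?case .
qed

lemma poly_higher_pderiv_monic:
  fixes p :: "real poly"
  assumes "degree p = m" "lead_coeff p = 1"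
  shows "poly ((pderiv ^^ m) p) x = fact m"
proof -
  have "degree ((pderiv ^^ m) p) = 0" using assms by (simp add: degree_higher_pderiv)
  then have "poly ((pderiv ^^ m) p) x = coeff ((pderiv ^^ m) p) 0"
    by (auto elim: degree_eq_zeroE)
  also have "\<dots> = fact m"
    using assms by (simp add: coeff_higher_pderiv pochhammer_fact[symmetric])
  finally show ?thesis .
qed

text \<open>The error term of Hermite interpolation has the sign of the nodal polynomial
  \<open>W x = (x - b) \<Prod>\<^bsub>e\<in>E\<^esub> (x - e) \<Prod>\<^bsub>d\<in>D\<^esub> (x - d)\<^sup>2\<close>, which is nonpositive on \<open>[a, b]\<close>. Double
  nodes are interior points, where derivatives exist, whereas the endpoints are simple nodes
  and only require continuity; \<open>E\<close> is empty or \<open>{a}\<close>.\<close>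
lemma hermite_interpolant_upper_bound:
  fixes F :: "nat \<Rightarrow> real \<Rightarrow> real"
  assumes ab: "a < b" and cont: "continuous_on {a..b} (F 0)"
    and der: "\<And>j x. j \<le> m \<Longrightarrow> x \<in> {a<..<b} \<Longrightarrow> (F j has_real_derivative F (Suc j) x) (at x)"
    and nonneg: "\<And>x. x \<in> {a<..<b} \<Longrightarrow> F (Suc m) x \<ge> 0"
    and E: "E \<subseteq> {a}" and D: "finite D" "D \<subseteq> {a<..<b}" and m: "m = card E + 2 * card D"
  shows "\<exists>G. degree G \<le> m \<and> (\<forall>x\<in>insert b (E \<union> D). poly G x = F 0 x) \<and>
             (\<forall>x\<in>{a..b}. F 0 x \<le> poly G x)"
proof -
  have finE: "finite E" using E finite_subset by auto
  define S where "S = insert b (E \<union> D)"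
  have finS: "finite S" unfolding S_def using finE D by simp
  have ED: "E \<inter> D = {}" "b \<notin> E \<union> D" using E D ab by auto
  have cS: "card S = Suc (card E + card D)"
    unfolding S_def using finE D ED by (simp add: card_Un_disjoint)
  obtain G where G: "degree G < card S + card D" "\<forall>x\<in>S. poly G x = F 0 x"
      "\<forall>x\<in>D. poly (pderiv G) x = F 1 x"
    using hermite_interpolation[of S D "F 0" "F 1"] finS D(1) unfolding S_def by auto
  have degG: "degree G \<le> m" using G(1) cS m by simp
  define V where "V = (\<Prod>d\<in>D. [:- d, 1:])"
  define U where "U = (\<Prod>e\<in>E. [:- e, 1:])"
  define W where "W = [:- b, 1:] * U * V\<^sup>2"
  have degW: "degree W = Suc m" and lcW: "lead_coeff W = 1"
  proof -
    have [simp]: "U \<noteq> 0" "V \<noteq> 0" unfolding U_def V_def using finE D(1) by (auto simp: prod_zero_iff)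
    have "degree U = card E" "degree V = card D"
      unfolding U_def V_def by (subst degree_prod_eq_sum_degree, auto)+
    then show "degree W = Suc m"
      unfolding W_def m
      by (simp add: degree_mult_eq degree_power_eq del: mult_pCons_left)
    have "lead_coeff U = 1" "lead_coeff V = 1"
      unfolding U_def V_def by (simp_all add: lead_coeff_prod)
    then show "lead_coeff W = 1"
      unfolding W_def by (simp add: lead_coeff_mult lead_coeff_power del: mult_pCons_left)
  qed
  have evW: "poly W x = (x - b) * (\<Prod>e\<in>E. x - e) * (\<Prod>d\<in>D. x - d)\<^sup>2" for x
    unfolding W_def U_def V_def by (simp add: poly_prod algebra_simps)
  have W_zero_iff: "poly W x = 0 \<longleftrightarrow> x \<in> S" for x
    unfolding evW S_def using finE D(1) by (auto simp: prod_zero_iff)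
  have W_nonpos: "poly W x \<le> 0" if "x \<in> {a..b}" for x
  proof -
    have "(\<Prod>e\<in>E. x - e) \<ge> 0" using E that by (intro prod_nonneg) auto
    then show ?thesis unfolding evW using that
      by (intro mult_nonpos_nonneg) (auto intro: mult_nonpos_nonneg)
  qed
  have dW: "poly (pderiv W) x = 0" if "x \<in> D" for x
  proof -
    have "poly V x = 0" unfolding V_def using that D(1) by (auto simp: poly_prod prod_zero_iff)
    then show ?thesis unfolding W_def by (simp add: pderiv_mult power2_eq_square)
  qed
  have le: "F 0 u \<le> poly G u" if u: "u \<in> {a..b}" for u
  proof (cases "u \<in> S")
    case True
    then show ?thesis using G by simp
  next
    case False
    then have Wu: "poly W u \<noteq> 0" using W_zero_iff by simp
    \<comment> \<open>The usual auxiliary function: subtracting \<open>c W\<close> from the error creates an extra zero at \<open>u\<close>.\<close>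
    define c where "c = (F 0 u - poly G u) / poly W u"
    define P where "P = G + smult c W"
    define \<psi> where "\<psi> j x = F j x - poly ((pderiv ^^ j) P) x" for j x
    have der\<psi>: "(\<psi> j has_real_derivative \<psi> (Suc j) x) (at x)" if "j \<le> m" "x \<in> {a<..<b}" for j x
      unfolding \<psi>_def using der[OF that] by (auto intro!: derivative_eq_intros)
    have Z: "\<exists>Z'. finite Z' \<and> card Z' = card E + card D + 1 \<and> Z' \<subseteq> {a<..<b} - insert u S \<and>
              (\<forall>z\<in>Z'. \<psi> 1 z = 0) \<and> (\<forall>z\<in>Z'. z < Max (insert u S))"
    proof (rule Rolle_finite_zeros[where f = "\<psi> 0"])
      show "continuous_on {a..b} (\<psi> 0)" unfolding \<psi>_def by (intro continuous_intros cont)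
      show "(\<psi> 0 has_real_derivative \<psi> 1 x) (at x)" if "x \<in> {a<..<b}" for x
        using der\<psi>[of 0] that by simp
      show "finite (insert u S)" using finS by simp
      show "insert u S \<subseteq> {a..b}" using u E D ab unfolding S_def by auto
      show "card (insert u S) = Suc (card E + card D + 1)" using finS False cS by simp
      fix z assume z: "z \<in> insert u S"
      show "\<psi> 0 z = 0"
      proof (cases "z = u")
        case True
        then show ?thesis using Wu by (simp add: \<psi>_def P_def c_def)
      next
        case False
        then have "z \<in> S" using z by simp
        then show ?thesis using G(2) W_zero_iff[of z] by (simp add: \<psi>_def P_def)
      qed
    qed
    then obtain Z' where Z': "finite Z'" "card Z' = card E + card D + 1"
      "Z' \<subseteq> {a<..<b} - insert u S" "\<forall>z\<in>Z'. \<psi> 1 z = 0" by blast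
    have "\<exists>z\<in>{a<..<b}. \<psi> (Suc m) z = 0"
    \<comment> \<open>The derivative vanishes at \<open>card E + card D + 1\<close> points between the zeros and at the
        double nodes \<open>D\<close>, hence at \<open>m + 1\<close> points.\<close>
    proof (rule iterated_Rolle[where F = "\<lambda>j. \<psi> (Suc j)" and Z = "Z' \<union> D"])
      show "(\<psi> (Suc j) has_real_derivative \<psi> (Suc (Suc j)) x) (at x)"
        if "j < m" "x \<in> {a<..<b}" for j x using der\<psi> that by simp
      show "finite (Z' \<union> D)" "Z' \<union> D \<subseteq> {a<..<b}" using Z' D by auto
      have "Z' \<inter> D = {}" using Z'(3) unfolding S_def by auto
      then show "card (Z' \<union> D) = Suc m" using Z' D m by (simp add: card_Un_disjoint)
      show "\<psi> (Suc 0) z = 0" if "z \<in> Z' \<union> D" for z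
      proof (cases "z \<in> D")
        case True
        then show ?thesis using G(3) dW by (simp add: \<psi>_def P_def pderiv_add pderiv_smult)
      next
        case False
        then show ?thesis using Z'(4) that by simp
      qed
    qed
    then obtain z where z: "z \<in> {a<..<b}" "\<psi> (Suc m) z = 0" by blast
    have "(pderiv ^^ Suc m) G = 0"
    proof -
      have "degree ((pderiv ^^ m) G) = 0" using degG by (simp add: degree_higher_pderiv)
      then show ?thesis by (simp add: pderiv_eq_0_iff)
    qed
    then have "\<psi> (Suc m) z = F (Suc m) z - c * fact (Suc m)"
      unfolding \<psi>_def P_def higher_pderiv_add higher_pderiv_smult poly_add poly_smult
        poly_higher_pderiv_monic[OF degW lcW] by simp
    then have "c * fact (Suc m) \<ge> 0" using z nonneg[of z] by simp
    then have "c \<ge> 0" by (simp only: zero_le_mult_iff) (use fact_gt_zero[of "Suc m", where ?'a = real] in linarith)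
    then have "c * poly W u \<le> 0" using W_nonpos[OF u] by (simp add: mult_nonneg_nonpos)
    then show ?thesis using Wu by (simp add: c_def)
  qed
  show ?thesis
    using degG G(2) le unfolding S_def by blast
qed

section \<open>Orthogonal polynomials for a positive functional\<close>

lemma poly_const_sign:
  fixes q :: "real poly"
  assumes "\<And>t. t \<in> {a<..<b} \<Longrightarrow> poly q t \<noteq> 0"
  shows "\<exists>c\<in>{1, -1}. \<forall>t\<in>{a<..<b}. c * poly q t > 0"
proof (rule ccontr)
  assume *: "\<not> ?thesis"
  then obtain x where x: "x \<in> {a<..<b}" "\<not> 1 * poly q x > 0" by blast
  from * obtain y where y: "y \<in> {a<..<b}" "\<not> (-1) * poly q y > 0" by blast
  have "poly q x < 0" "poly q y > 0" using x y assms[of x] assms[of y] by auto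
  then have "x \<noteq> y" "poly q x * poly q y < 0" "poly q y * poly q x < 0"
    by (auto simp: mult_less_0_iff)
  then obtain z where "min x y < z" "z < max x y" "poly q z = 0"
    using poly_IVT[of x y q] poly_IVT[of y x q] by (cases x y rule: linorder_cases) auto
  moreover have "a < min x y" "max x y < b" using x y by auto
  ultimately have "z \<in> {a<..<b}" by auto
  then show False using assms[of z] \<open>poly q z = 0\<close> by simp
qed

text \<open>\<open>A\<close> collects the zeros in \<open>(a, b)\<close> at which \<open>q\<close> changes sign, so multiplying by its nodal
  polynomial makes all multiplicities in \<open>(a, b)\<close> even. The product is recorded as a square times
  a factor without zeros because the orthogonality argument needs the square.\<close>
lemma sign_change_factor:
  fixes q :: "real poly"
  assumes "q \<noteq> 0"
  shows "\<exists>A c r g. finite A \<and> A \<subseteq> {t\<in>{a<..<b}. poly q t = 0} \<and> c \<noteq> 0 \<and>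
           (\<Prod>x\<in>A. [:- x, 1:]) * smult c q = r\<^sup>2 * g \<and> (\<forall>t\<in>{a<..<b}. poly g t > 0)"
  using assms
proof (induction "degree q" arbitrary: q rule: less_induct)
  case less
  show ?case
  proof (cases "\<exists>t\<in>{a<..<b}. poly q t = 0")
    case False
    then obtain c where "c \<in> {1, -1}" "\<forall>t\<in>{a<..<b}. c * poly q t > 0"
      using poly_const_sign[of a b q] by blast
    then show ?thesis
      by (intro exI[of _ "{}"] exI[of _ c] exI[of _ 1] exI[of _ "smult c q"]) auto
  next
    case True
    then obtain x where x: "x \<in> {a<..<b}" "poly q x = 0" by blast
    then obtain q' where q': "q = [:- x, 1:] * q'" by (auto simp: poly_eq_0_iff_dvd dvd_def)
    have q'0: "q' \<noteq> 0" using q' less.prems by auto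
    have "degree q' < degree q"
      unfolding q' using q'0 by (subst degree_mult_eq) auto
    from less.hyps[OF this q'0] obtain A c r g where
      IH: "finite A" "A \<subseteq> {t\<in>{a<..<b}. poly q' t = 0}" "c \<noteq> 0"
        "(\<Prod>x\<in>A. [:- x, 1:]) * smult c q' = r\<^sup>2 * g" "\<forall>t\<in>{a<..<b}. poly g t > 0" by (elim exE conjE) (rule that)
    show ?thesis
    proof (cases "x \<in> A")
      case True
      have "(\<Prod>x\<in>A - {x}. [:- x, 1:]) * smult c q = (\<Prod>x\<in>A. [:- x, 1:]) * smult c q'"
        unfolding q' using IH(1) True by (simp add: prod.remove[of A x] algebra_simps del: mult_pCons_left mult_pCons_right)
      then show ?thesis
        using IH True q' by (intro exI[of _ "A - {x}"] exI[of _ c] exI[of _ r] exI[of _ g]) auto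
    next
      case False
      have "(\<Prod>x\<in>insert x A. [:- x, 1:]) * smult c q
              = [:- x, 1:]\<^sup>2 * ((\<Prod>x\<in>A. [:- x, 1:]) * smult c q')"
        unfolding q' using IH(1) False
        by (simp add: power2_eq_square algebra_simps del: mult_pCons_left mult_pCons_right)
      also have "\<dots> = ([:- x, 1:] * r)\<^sup>2 * g"
        unfolding IH(4) by (simp only: power_mult_distrib mult.assoc)
      finally show ?thesis
        using IH x q' by (intro exI[of _ "insert x A"] exI[of _ c]
            exI[of _ "[:- x, 1:] * r"] exI[of _ g]) auto
    qed
  qed
qed

text \<open>Orthogonality is developed for a linear functional rather than for a measure, since it is applied
  to the Gegenbauer measure as well as to the signed measure \<open>\<nu>\<^sub>s\<close>, which is positive on
  polynomials of low degree only. Accordingly every positivity hypothesis below is restricted by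
  degree.\<close>
locale poly_functional =
  fixes L :: "real poly \<Rightarrow> real"
  assumes add: "L (p + q) = L p + L q"
    and smult: "L (smult c p) = c * L p"
begin

lemma zero: "L 0 = 0" using smult[of 0 0] by simp

lemma diff: "L (p - q) = L p - L q"
  using add[of p "smult (-1) q"] smult[of "-1" q] by simp

lemma sum: "L (\<Sum>i\<in>A. f i) = (\<Sum>i\<in>A. L (f i))"
  by (induction A rule: infinite_finite_induct) (simp_all add: zero add)

definition orthogonal_below :: "nat \<Rightarrow> real poly \<Rightarrow> bool" where
  "orthogonal_below m q \<longleftrightarrow> (\<forall>p. degree p < m \<longrightarrow> L (q * p) = 0)"

lemma orthogonal_belowD: "orthogonal_below m q \<Longrightarrow> degree p < m \<Longrightarrow> L (q * p) = 0"
  unfolding orthogonal_below_def by blast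

lemma orthogonal_to_span:
  assumes "\<And>l. l < m \<Longrightarrow> degree (P l) = l" "\<And>l. l < m \<Longrightarrow> P l \<noteq> 0"
    and "\<And>l. l < m \<Longrightarrow> L (q * P l) = 0"
  shows "orthogonal_below m q"
proof -
  have "degree p < m \<longrightarrow> L (q * p) = 0" for p
  proof (induction "degree p" arbitrary: p rule: less_induct)
    case less
    show ?case
    proof
      assume lt: "degree p < m"
      define l where "l = degree p"
      define c where "c = lead_coeff p / lead_coeff (P l)"
      have P: "degree (P l) = l" "P l \<noteq> 0" "L (q * P l) = 0" using assms lt unfolding l_def by auto
      define p' where "p' = p - smult c (P l)"
      have eq: "L (q * p) = L (q * p') + c * L (q * P l)"
        unfolding p'_def by (simp add: algebra_simps diff smult)
      show "L (q * p) = 0"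
      proof (cases "p' = 0")
        case True
        then show ?thesis using eq P zero by simp
      next
        case False
        have "coeff (P l) l \<noteq> 0" using P(1,2) by (metis leading_coeff_0_iff)
        then have "coeff p' l = 0" unfolding p'_def c_def using P(1) by (simp add: l_def)
        moreover have "degree p' \<le> l"
          unfolding p'_def using P(1) by (intro degree_diff_le) (auto simp: l_def)
        ultimately have "degree p' < l"
          using False by (metis le_neq_implies_less leading_coeff_0_iff)
        then show ?thesis using less[of p'] eq P lt unfolding l_def by simp
      qed
    qed
  qed
  then show ?thesis unfolding orthogonal_below_def by blast
qed

text \<open>Gram--Schmidt, applied to the monomial of degree \<open>m\<close> and the orthogonal polynomials of lower
  degree.\<close>
lemma orthogonal_poly_exists:
  assumes "\<And>p. p \<noteq> 0 \<Longrightarrow> degree p < m \<Longrightarrow> L (p\<^sup>2) > 0"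
  shows "\<exists>q. degree q = m \<and> lead_coeff q = 1 \<and> orthogonal_below m q"
  using assms
proof (induction m rule: less_induct)
  case (less m)
  have "\<forall>l<m. \<exists>q. degree q = l \<and> lead_coeff q = 1 \<and> orthogonal_below l q"
    using less by auto
  then obtain P where P: "\<And>l. l < m \<Longrightarrow> degree (P l) = l" "\<And>l. l < m \<Longrightarrow> lead_coeff (P l) = 1"
    "\<And>l. l < m \<Longrightarrow> orthogonal_below l (P l)" by metis
  have P0: "P l \<noteq> 0" if "l < m" for l using P(2)[OF that] by auto
  have orth: "L (P i * P j) = 0" if "i < m" "j < m" "i \<noteq> j" for i j
    using that orthogonal_belowD[OF P(3), of i "P j"] orthogonal_belowD[OF P(3), of j "P i"] P(1)
    by (cases i j rule: linorder_cases) (auto simp: mult.commute)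
  have nz: "L (P i * P i) \<noteq> 0" if "i < m" for i
    using less.prems[OF P0[OF that]] P(1)[OF that] that by (simp add: power2_eq_square)
  define s where "s = (\<Sum>i<m. smult (L (monom 1 m * P i) / L (P i * P i)) (P i))"
  define q where "q = monom 1 m - s"
  have low: "degree s < m" if "m > 0"
    unfolding s_def by (rule degree_sum_less) (use P(1) that in \<open>auto intro: le_less_trans[OF degree_smult_le]\<close>)
  have deg: "degree q = m \<and> lead_coeff q = 1"
  proof (cases "m = 0")
    case True
    then show ?thesis by (simp add: q_def s_def)
  next
    case False
    then have "degree s < m" using low by simp
    then have "degree q \<le> m" "coeff q m = 1"
      unfolding q_def by (auto intro!: degree_diff_le simp: degree_monom_eq coeff_eq_0)
    moreover have "degree q \<ge> m" using \<open>coeff q m = 1\<close> by (intro le_degree) simp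
    ultimately show ?thesis by simp
  qed
  have "orthogonal_below m q"
  proof (rule orthogonal_to_span[where P = P])
    fix l assume l: "l < m"
    have "L (s * P l) = (\<Sum>i<m. L (monom 1 m * P i) / L (P i * P i) * L (P i * P l))"
      unfolding s_def by (simp add: sum_distrib_right sum smult)
    also have "\<dots> = (\<Sum>i<m. if i = l then L (monom 1 m * P l) else 0)"
      by (rule sum.cong) (use orth nz l in auto)
    also have "\<dots> = L (monom 1 m * P l)" using l by simp
    finally show "L (q * P l) = 0"
      unfolding q_def by (simp add: left_diff_distrib diff)
  qed (use P P0 in auto)
  then show ?case using deg by blast
qed

text \<open>The cross-multiplied difference has degree below \<open>m\<close> and is orthogonal to itself.\<close>
lemma orthogonal_poly_unique:
  assumes pos: "\<And>p. p \<noteq> 0 \<Longrightarrow> degree p < m \<Longrightarrow> L (p\<^sup>2) > 0"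
    and q: "degree q = m" "orthogonal_below m q" "degree q' = m" "orthogonal_below m q'"
  shows "smult (lead_coeff q') q = smult (lead_coeff q) q'"
proof -
  define d where "d = smult (lead_coeff q') q - smult (lead_coeff q) q'"
  have "d = 0"
  proof (rule ccontr)
    assume "d \<noteq> 0"
    have "coeff d m = 0" unfolding d_def using q by simp
    moreover have "degree d \<le> m" unfolding d_def using q by (intro degree_diff_le) auto
    ultimately have deg: "degree d < m" using \<open>d \<noteq> 0\<close> by (metis le_neq_implies_less leading_coeff_0_iff)
    have "L (d * d) = lead_coeff q' * L (q * d) - lead_coeff q * L (q' * d)"
      unfolding d_def by (simp add: left_diff_distrib diff smult)
    also have "\<dots> = 0" using orthogonal_belowD q deg by simp
    finally show False using pos[OF \<open>d \<noteq> 0\<close> deg] by (simp add: power2_eq_square)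
  qed
  then show ?thesis unfolding d_def by simp
qed

lemma orthogonal_poly_parity:
  assumes pos: "\<And>p. p \<noteq> 0 \<Longrightarrow> degree p < m \<Longrightarrow> L (p\<^sup>2) > 0"
    and even: "\<And>p. L (pcompose p [:0, -1:]) = L p"
    and q: "degree q = m" "orthogonal_below m q"
  shows "poly q (- t) = (-1) ^ m * poly q t"
proof (cases "q = 0")
  case True
  then show ?thesis by simp
next
  case False
  define q' where "q' = pcompose q [:0, -1:]"
  have deg: "degree q' = m" unfolding q'_def by (simp add: degree_pcompose q)
  have lc: "lead_coeff q' = lead_coeff q * (-1) ^ m"
    unfolding q'_def by (subst lead_coeff_comp) (auto simp: q)
  have "orthogonal_below m q'"
    unfolding orthogonal_below_def
  proof (intro allI impI)
    fix p :: "real poly" assume p: "degree p < m"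
    have "L (q' * p) = L (pcompose (q' * p) [:0, -1:])" by (simp add: even)
    also have "pcompose (q' * p) [:0, -1:] = q * pcompose p [:0, -1:]"
      unfolding q'_def by (simp add: pcompose_mult pcompose_assoc[symmetric] pcompose_pCons)
    also have "L \<dots> = 0" using p by (intro orthogonal_belowD[OF q(2)]) (simp add: degree_pcompose)
    finally show "L (q' * p) = 0" .
  qed
  from orthogonal_poly_unique[OF pos q deg this]
  have "smult (lead_coeff q) (smult ((-1) ^ m) q) = smult (lead_coeff q) q'"
    unfolding lc by (simp add: mult.commute)
  then have "smult ((-1) ^ m) q = q'" using False
    by (metis leading_coeff_0_iff smult_cancel smult_smult)
  then have "poly q' t = (-1) ^ m * poly q t" by (metis poly_smult)
  then show ?thesis unfolding q'_def by (simp add: poly_pcompose)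
qed

text \<open>If \<open>q\<close> changed sign at fewer than \<open>m\<close> points of \<open>(a, b)\<close>, the nodal polynomial \<open>p\<close> of these
  points would have degree below \<open>m\<close>, and \<open>L (q p) = 0\<close> although \<open>c q p = r\<^sup>2 g\<close> with \<open>g > 0\<close>. The
  positivity hypothesis is made for products \<open>r\<^sup>2 g\<close> with \<open>degree r < m\<close> instead of for arbitrary
  polynomials that are nonnegative on \<open>(a, b)\<close>: in this form it is easily checked even for a
  discrete measure with only \<open>m\<close> atoms.\<close>
lemma orthogonal_poly_roots:
  assumes pos: "\<And>r g. r \<noteq> 0 \<Longrightarrow> degree r < m \<Longrightarrow> degree (r\<^sup>2 * g) < 2 * m \<Longrightarrow>
                  (\<And>t. t \<in> {a<..<b} \<Longrightarrow> poly g t > 0) \<Longrightarrow> L (r\<^sup>2 * g) > 0"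
    and q: "q \<noteq> 0" "degree q = m" "orthogonal_below m q"
  shows "card {t. poly q t = 0} = m \<and> {t. poly q t = 0} \<subseteq> {a<..<b}"
proof -
  obtain A c r g where A: "finite A" "A \<subseteq> {t\<in>{a<..<b}. poly q t = 0}" "c \<noteq> 0"
    "(\<Prod>x\<in>A. [:- x, 1:]) * smult c q = r\<^sup>2 * g" "\<forall>t\<in>{a<..<b}. poly g t > 0"
    using sign_change_factor[OF q(1), of a b] by (elim exE conjE) (rule that)
  define p where "p = (\<Prod>x\<in>A. [:- x, 1:])"
  have p: "degree p = card A" "p \<noteq> 0"
    unfolding p_def using A(1) by (simp_all add: degree_prod_eq_sum_degree prod_zero_iff)
  have fin: "finite {t. poly q t = 0}" using q(1) by (rule poly_roots_finite)
  have "card A \<ge> m"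
  proof (rule ccontr)
    assume "\<not> ?thesis"
    then have lt: "degree p < m" using p by simp
    have ne: "r\<^sup>2 * g \<noteq> 0" using A(3,4) p(2) q(1) unfolding p_def[symmetric] by (metis mult_eq_0_iff smult_eq_0_iff)
    have deg: "degree (r\<^sup>2 * g) = degree p + m"
      using A(3,4) p(2) q unfolding p_def[symmetric] by (metis degree_mult_eq degree_smult_eq smult_eq_0_iff)
    have "degree (r\<^sup>2 * g) = 2 * degree r + degree g"
      using ne by (subst degree_mult_eq) (auto simp: degree_power_eq)
    then have "degree r < m" using deg lt by linarith
    moreover have "r \<noteq> 0" using ne by auto
    ultimately have "L (r\<^sup>2 * g) > 0" using deg lt A(5) by (intro pos) auto
    moreover have "L (r\<^sup>2 * g) = c * L (q * p)"
      unfolding A(4)[symmetric] p_def[symmetric] by (simp add: smult mult.commute)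
    ultimately show False using orthogonal_belowD[OF q(3) lt] by simp
  qed
  moreover have sub: "A \<subseteq> {t. poly q t = 0}" using A(2) by auto
  moreover have "card {t. poly q t = 0} \<le> m" using card_poly_roots_bound[OF q(1)] q(2) by simp
  moreover have "card A \<le> card {t. poly q t = 0}" using sub fin by (rule card_mono[rotated])
  ultimately have "A = {t. poly q t = 0}" "card A = m"
    using fin by (simp_all add: card_subset_eq)
  then show ?thesis using A(2) by auto
qed

end

section \<open>The Gegenbauer measure\<close>

definition geg_int :: "nat \<Rightarrow> real poly \<Rightarrow> real" where
  "geg_int n p = (LINT t|gegenbauer_measure n. poly p t)"

text \<open>The Gegenbauer weight before normalization, cut off outside \<open>[-1, 1]\<close>.\<close>
definition jacobi_weight :: "nat \<Rightarrow> real \<Rightarrow> real" where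
  "jacobi_weight n t = indicator {-1..1} t * (1 - t\<^sup>2) powr ((real n - 3) / 2)"

lemma jacobi_weight_nonneg: "jacobi_weight n t \<ge> 0"
  unfolding jacobi_weight_def by simp

lemma jacobi_weight_pos: "t \<in> {-1<..<1} \<Longrightarrow> jacobi_weight n t > 0"
  using abs_square_less_1[of t] by (auto simp: jacobi_weight_def abs_less_iff)

lemma measurable_jacobi_weight [measurable]: "jacobi_weight n \<in> borel_measurable borel"
  unfolding jacobi_weight_def by measurable

text \<open>In dimension 2 the weight is unbounded; its antiderivative is the arcsine. It dominates the
  weights of all higher dimensions.\<close>
lemma integrable_arcsin_weight: "integrable lborel (jacobi_weight 2)"
proof -
  let ?f = "\<lambda>t::real. (1 - t\<^sup>2) powr (- 1 / 2)"
  have der: "(arcsin has_real_derivative ?f t) (at t)" if "t \<in> {-1<..<1}" for t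
  proof -
    have "t\<^sup>2 < 1" using that by (simp add: abs_square_less_1 abs_less_iff)
    then have "?f t = inverse (sqrt (1 - t\<^sup>2))"
      by (simp add: powr_minus powr_half_sqrt)
    then show ?thesis using DERIV_arcsin[of t] that by simp
  qed
  have "(?f has_integral (arcsin 1 - arcsin (- 1))) {-1..1}"
    by (rule fundamental_theorem_of_calculus_interior)
       (use der in \<open>auto simp: has_real_derivative_iff_has_vector_derivative[symmetric]
          intro!: continuous_on_arcsin'\<close>)
  then have "?f absolutely_integrable_on {-1..1}"
    by (intro nonnegative_absolutely_integrable_1) (auto simp: integrable_on_def)
  then have "integrable lebesgue (\<lambda>t. indicator {-1..1} t *\<^sub>R ?f t)"
    by (simp add: set_integrable_def)
  moreover have "(\<lambda>t. indicator {-1..1} t *\<^sub>R ?f t) = jacobi_weight 2"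
    by (auto simp: jacobi_weight_def)
  ultimately show ?thesis
    using integrable_completion[of "jacobi_weight 2" lborel] by simp
qed

lemma integrable_jacobi_weight:
  assumes "n \<ge> 2"
  shows "integrable lborel (jacobi_weight n)"
proof (rule Bochner_Integration.integrable_bound[OF integrable_arcsin_weight])
  show "AE t in lborel. norm (jacobi_weight n t) \<le> norm (jacobi_weight 2 t)"
  proof (rule AE_I2)
    fix t :: real
    have "(1 - t\<^sup>2) powr ((real n - 3) / 2) \<le> (1 - t\<^sup>2) powr ((real 2 - 3) / 2)" if "t \<in> {-1..1}"
    proof (rule powr_mono')
      have "t\<^sup>2 \<le> 1" using that by (simp add: abs_square_le_1 abs_le_iff)
      then show "0 \<le> 1 - t\<^sup>2" "1 - t\<^sup>2 \<le> 1" by auto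
    qed (use assms in simp)
    then show "norm (jacobi_weight n t) \<le> norm (jacobi_weight 2 t)"
      by (auto simp: jacobi_weight_def indicator_def)
  qed
qed simp

lemma integrable_jacobi_weight_poly:
  assumes "n \<ge> 2"
  shows "integrable lborel (\<lambda>t. jacobi_weight n t * poly p t)"
proof -
  have "compact (poly p ` {-1..1})"
    by (intro compact_continuous_image continuous_intros compact_Icc)
  then obtain K where K: "\<And>t. t \<in> {-1..1} \<Longrightarrow> \<bar>poly p t\<bar> \<le> K"
    by (force dest!: compact_imp_bounded simp: bounded_iff)
  have K0: "K \<ge> 0" using K[of 0] by simp
  show ?thesis
  proof (rule Bochner_Integration.integrable_bound)
    show "integrable lborel (\<lambda>t. K * jacobi_weight n t)"
      using integrable_jacobi_weight[OF assms] by simp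
    show "(\<lambda>t. jacobi_weight n t * poly p t) \<in> borel_measurable lborel"
      by (intro borel_measurable_times) (auto intro!: borel_measurable_continuous_onI continuous_intros)
    show "AE t in lborel. norm (jacobi_weight n t * poly p t) \<le> norm (K * jacobi_weight n t)"
    proof (rule AE_I2)
      fix t
      show "norm (jacobi_weight n t * poly p t) \<le> norm (K * jacobi_weight n t)"
      proof (cases "t \<in> {-1..1}")
        case True
        then show ?thesis using K[OF True] K0 jacobi_weight_nonneg[of n t]
          by (simp add: abs_mult mult.commute[of K] mult_left_mono)
      next
        case False
        then show ?thesis by (simp add: jacobi_weight_def)
      qed
    qed
  qed
qed

lemma jacobi_integral_pos:
  assumes "n \<ge> 2" "p \<noteq> 0" "\<And>t. t \<in> {-1<..<1} \<Longrightarrow> poly p t \<ge> 0"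
  shows "(LINT t|lborel. jacobi_weight n t * poly p t) > 0"
proof -
  let ?f = "\<lambda>t. jacobi_weight n t * poly p t"
  have p1: "poly p t \<ge> 0" if "t \<in> {-1..1}" for t
  proof (rule continuous_ge_on_closure[of "{-1<..<1}" "poly p" t 0])
    show "t \<in> closure {-1<..<1}" using that by (simp add: closure_greaterThanLessThan)
  qed (use assms(3) in \<open>auto intro!: continuous_intros\<close>)
  have nn: "?f t \<ge> 0" for t
    using p1[of t] by (cases "t \<in> {-1..1}") (auto simp: jacobi_weight_def)
  have "(LINT t|lborel. ?f t) \<noteq> 0"
  proof
    assume "(LINT t|lborel. ?f t) = 0"
    then have "AE t in lborel. ?f t = 0"
      using integral_nonneg_eq_0_iff_AE[OF integrable_jacobi_weight_poly[OF assms(1)], of p] nn by simp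
    moreover have "finite {t. poly p t = 0}" using assms(2) by (rule poly_roots_finite)
    then have "AE t in lborel. t \<notin> {t. poly p t = 0}"
      by (intro AE_not_in countable_imp_null_set_lborel countable_finite)
    ultimately have "AE t in lborel. t \<notin> {-1<..<1::real}"
    proof eventually_elim
      case (elim t)
      then show ?case using jacobi_weight_pos[of t n] by auto
    qed
    then have "emeasure lborel {-1<..<1::real} = 0"
      by (subst (asm) AE_iff_measurable[where N = "{-1<..<1::real}"]) auto
    then show False by simp
  qed
  moreover have "(LINT t|lborel. ?f t) \<ge> 0" using nn by (intro integral_nonneg_AE AE_I2)
  ultimately show ?thesis by simp
qed

lemma gegenbauer_const_eq: "gegenbauer_const n = 1 / (LINT t|lborel. jacobi_weight n t)"
  unfolding gegenbauer_const_def jacobi_weight_def set_lebesgue_integral_def by simp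

lemma gegenbauer_const_pos:
  assumes "n \<ge> 2"
  shows "gegenbauer_const n > 0"
  using jacobi_integral_pos[OF assms, of 1] by (simp add: gegenbauer_const_eq)

lemma gegenbauer_weight_eq:
  "indicator {-1..1} t * gegenbauer_weight n t = gegenbauer_const n * jacobi_weight n t"
  by (simp add: gegenbauer_weight_def jacobi_weight_def)

lemma geg_int_eq:
  assumes "n \<ge> 2"
  shows "geg_int n p = gegenbauer_const n * (LINT t|lborel. jacobi_weight n t * poly p t)"
proof -
  have nn: "gegenbauer_const n * jacobi_weight n t \<ge> 0" for t
    using gegenbauer_const_pos[OF assms] jacobi_weight_nonneg by simp
  have "geg_int n p = (LINT t|lborel. (gegenbauer_const n * jacobi_weight n t) *\<^sub>R poly p t)"
    unfolding geg_int_def gegenbauer_measure_def gegenbauer_weight_eq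
    by (rule integral_density)
       (use nn in \<open>auto intro!: borel_measurable_continuous_onI continuous_intros\<close>)
  also have "\<dots> = gegenbauer_const n * (LINT t|lborel. jacobi_weight n t * poly p t)"
    by (simp add: mult.assoc)
  finally show ?thesis .
qed

lemma geg_int_poly_functional:
  assumes "n \<ge> 2"
  shows "poly_functional (geg_int n)"
proof
  show "geg_int n (p + q) = geg_int n p + geg_int n q" for p q
    using integrable_jacobi_weight_poly[OF assms]
    by (simp add: geg_int_eq[OF assms] algebra_simps)
  show "geg_int n (smult c p) = c * geg_int n p" for c p
    by (simp add: geg_int_eq[OF assms] mult.left_commute)
qed

lemma geg_int_1:
  assumes "n \<ge> 2"
  shows "geg_int n 1 = 1"
  using jacobi_integral_pos[OF assms, of 1] by (simp add: geg_int_eq[OF assms] gegenbauer_const_eq)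

lemma geg_int_pos:
  assumes "n \<ge> 2" "p \<noteq> 0" "\<And>t. t \<in> {-1<..<1} \<Longrightarrow> poly p t \<ge> 0"
  shows "geg_int n p > 0"
  using jacobi_integral_pos[OF assms] gegenbauer_const_pos[OF assms(1)]
  by (simp add: geg_int_eq[OF assms(1)])

lemma geg_int_reflect:
  assumes "n \<ge> 2"
  shows "geg_int n (pcompose p [:0, -1:]) = geg_int n p"
proof -
  have w: "jacobi_weight n (- t) = jacobi_weight n t" for t
    by (auto simp: jacobi_weight_def indicator_def)
  have "(LINT t|lborel. jacobi_weight n t * poly p t)
          = (LINT t|lborel. jacobi_weight n (- t) * poly p (- t))"
    using lborel_integral_real_affine[of "-1" "\<lambda>t. jacobi_weight n t * poly p t" 0] by simp
  then show ?thesis by (simp add: geg_int_eq[OF assms] poly_pcompose w)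
qed

lemma geg_int_odd_power:
  assumes "n \<ge> 2" "odd j"
  shows "geg_int n (monom 1 j) = 0"
proof -
  interpret poly_functional "geg_int n" using assms(1) by (rule geg_int_poly_functional)
  have "pcompose (monom 1 j) [:0, -1:] = smult (-1) (monom (1::real) j)"
    using assms(2) by (intro poly_eqI) (auto simp: coeff_pcompose_linear)
  then have "geg_int n (monom 1 j) = - geg_int n (monom 1 j)"
    using geg_int_reflect[OF assms(1), of "monom 1 j"] smult[of "-1" "monom 1 j"] by simp
  then show ?thesis by simp
qed

text \<open>Integration by parts: on \<open>(-1, 1)\<close>, the difference of the two integrands is, up to sign, the
  derivative of \<open>t\<^bsup>2j+1\<^esup> (1 - t\<^sup>2)\<^bsup>(n-1)/2\<^esup>\<close>, which vanishes at both endpoints.\<close>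
lemma geg_int_even_power_rec:
  assumes n: "n \<ge> 2"
  shows "real (2 * j + n) * geg_int n (monom 1 (2 * j + 2)) = real (2 * j + 1) * geg_int n (monom 1 (2 * j))"
proof -
  define b where "b = (real n - 1) / 2"
  have b: "b > 0" "b - 1 = (real n - 3) / 2" using n by (auto simp: b_def field_simps)
  have nb: "real n = 2 * b + 1" by (simp add: b_def field_simps)
  define p where "p = monom (real (2 * j + 1)) (2 * j) - monom (real (2 * j + n)) (2 * j + 2)"
  let ?F = "\<lambda>t::real. t ^ (2 * j + 1) * (1 - t\<^sup>2) powr b"
  let ?f = "\<lambda>t::real. (1 - t\<^sup>2) powr ((real n - 3) / 2) * poly p t"
  have der: "(?F has_real_derivative ?f t) (at t)" if "t \<in> {-1<..<1}" for t
  proof -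
    have t: "1 - t\<^sup>2 > 0" using that by (simp add: abs_square_less_1 abs_less_iff)
    have split: "(1 - t\<^sup>2) powr b = (1 - t\<^sup>2) * (1 - t\<^sup>2) powr (b - 1)"
      using t by (simp add: powr_diff)
    have "((\<lambda>t. (1 - t\<^sup>2) powr b) has_real_derivative b * (1 - t\<^sup>2) powr (b - of_nat 1) * (- 2 * t)) (at t)"
      using t by (intro DERIV_fun_powr) (auto intro!: derivative_eq_intros)
    then have "(?F has_real_derivative
        (2 * j + 1) * t ^ (2 * j) * (1 - t\<^sup>2) powr b + t ^ (2 * j + 1) * (b * (1 - t\<^sup>2) powr (b - 1) * (- 2 * t))) (at t)"
      by (rule DERIV_cong[OF DERIV_mult[OF DERIV_pow[of "2 * j + 1" t UNIV]]]) (simp add: algebra_simps)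
    moreover have "(2 * j + 1) * t ^ (2 * j) * (1 - t\<^sup>2) powr b + t ^ (2 * j + 1) * (b * (1 - t\<^sup>2) powr (b - 1) * (- 2 * t))
        = (1 - t\<^sup>2) powr (b - 1) * poly p t"
      unfolding split p_def by (simp add: poly_monom nb algebra_simps power2_eq_square)
    ultimately show ?thesis unfolding b(2) by simp
  qed
  have "continuous_on {-1..1} ?F"
    using b(1) by (intro continuous_intros continuous_on_powr')
      (auto simp: abs_square_le_1 abs_le_iff)
  then have "(?f has_integral (?F 1 - ?F (-1))) {-1..1}"
    by (intro fundamental_theorem_of_calculus_interior)
       (use der in \<open>auto simp: has_real_derivative_iff_has_vector_derivative[symmetric]\<close>)
  then have "integral {-1..1} ?f = 0" by (intro integral_unique) simp
  moreover have eq: "indicator {-1..1} t *\<^sub>R ?f t = jacobi_weight n t * poly p t" for t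
    by (simp add: jacobi_weight_def)
  have "set_integrable lborel {-1..1} ?f"
    using integrable_jacobi_weight_poly[OF n, of p] unfolding set_integrable_def eq .
  then have "(LINT t:{-1..1}|lborel. ?f t) = integral {-1..1} ?f"
    by (rule set_borel_integral_eq_integral)
  ultimately have "(LINT t|lborel. jacobi_weight n t * poly p t) = 0"
    unfolding set_lebesgue_integral_def eq by simp
  then have 0: "geg_int n p = 0" by (simp add: geg_int_eq[OF n])
  interpret poly_functional "geg_int n" using n by (rule geg_int_poly_functional)
  have "p = smult (2 * j + 1) (monom 1 (2 * j)) - smult (2 * j + n) (monom 1 (2 * j + 2))"
    unfolding p_def by (simp add: smult_monom)
  then show ?thesis using 0 by (simp only: diff smult)
qed

lemma nu_integral_eq:
  assumes "n \<ge> 2"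
  shows "nu_integral n s (poly p) = geg_int n (p * [:s\<^sup>2, 0, -1:])"
proof -
  have "nu_integral n s (poly p) =
      (LINT t|lborel. gegenbauer_const n * (jacobi_weight n t * poly (p * [:s\<^sup>2, 0, -1:]) t))"
    unfolding nu_integral_def set_lebesgue_integral_def
    by (rule Bochner_Integration.integral_cong)
       (auto simp: gegenbauer_weight_def jacobi_weight_def power2_eq_square algebra_simps)
  then show ?thesis by (simp add: geg_int_eq[OF assms])
qed

text \<open>The definite description is justified by Gram--Schmidt and by the uniqueness of orthogonal
  polynomials up to a factor. The normalization at \<open>1\<close> is possible as all zeros lie in \<open>(-1, 1)\<close>.\<close>
lemma gegenbauer_poly_spec:
  assumes n: "n \<ge> 2"
  shows "degree (gegenbauer_poly n l) = l" "poly (gegenbauer_poly n l) 1 = 1"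
    and "l \<noteq> m \<Longrightarrow> geg_int n (gegenbauer_poly n l * gegenbauer_poly n m) = 0"
proof -
  interpret poly_functional "geg_int n" using n by (rule geg_int_poly_functional)
  define spec where "spec P \<longleftrightarrow> (\<forall>l. degree (P l) = l \<and> poly (P l) 1 = 1) \<and>
     (\<forall>l m. l \<noteq> m \<longrightarrow> geg_int n (P l * P m) = 0)" for P :: "nat \<Rightarrow> real poly"
  have pos: "geg_int n (p\<^sup>2) > 0" if "p \<noteq> 0" for p
    using that by (intro geg_int_pos[OF n]) auto
  have "\<exists>q. degree q = l \<and> poly q 1 = 1 \<and> orthogonal_below l q" for l
  proof -
    obtain q where q: "degree q = l" "lead_coeff q = 1" "orthogonal_below l q"
      using orthogonal_poly_exists[of l] pos by blast
    then have q0: "q \<noteq> 0" by auto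
    have "{t. poly q t = 0} \<subseteq> {-1<..<1}"
    proof (rule conjunct2[OF orthogonal_poly_roots[OF _ q0 q(1,3)]])
      fix r g :: "real poly" assume rg: "r \<noteq> 0" "\<And>t. t \<in> {-1<..<1} \<Longrightarrow> poly g t > 0"
      have "g \<noteq> 0" using rg(2)[of 0] by auto
      then show "geg_int n (r\<^sup>2 * g) > 0"
        using rg by (intro geg_int_pos[OF n]) (auto intro!: mult_nonneg_nonneg intro: less_imp_le)
    qed
    then have q1: "poly q 1 \<noteq> 0" by auto
    then have "degree (smult (1 / poly q 1) q) = l \<and> poly (smult (1 / poly q 1) q) 1 = 1 \<and>
        orthogonal_below l (smult (1 / poly q 1) q)"
      using q unfolding orthogonal_below_def by (simp add: smult)
    then show ?thesis by blast
  qed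
  then obtain P where P: "\<And>l. degree (P l) = l" "\<And>l. poly (P l) 1 = 1"
    "\<And>l. orthogonal_below l (P l)" by metis
  have orth: "geg_int n (P l * P m) = 0" if "l \<noteq> m" for l m
    using that orthogonal_belowD[OF P(3), of "P m" l] orthogonal_belowD[OF P(3), of "P l" m] P(1)
    by (cases l m rule: linorder_cases) (auto simp: mult.commute)
  have specP: "spec P" unfolding spec_def using P orth by blast
  have uniq: "Q = P" if "spec Q" for Q
  proof
    fix l
    have Q: "degree (Q l) = l" "poly (Q l) 1 = 1" "orthogonal_below l (Q l)"
    proof -
      show "orthogonal_below l (Q l)"
      proof (rule orthogonal_to_span[where P = Q])
        show "Q i \<noteq> 0" for i
        proof
          assume "Q i = 0"
          moreover have "poly (Q i) 1 = 1" using that unfolding spec_def by blast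
          ultimately show False by simp
        qed
      qed (use that in \<open>auto simp: spec_def\<close>)
    qed (use that in \<open>auto simp: spec_def\<close>)
    have eq: "smult (lead_coeff (P l)) (Q l) = smult (lead_coeff (Q l)) (P l)"
      by (rule orthogonal_poly_unique[OF pos Q(1,3) P(1,3)])
    then have "poly (smult (lead_coeff (P l)) (Q l)) 1 = poly (smult (lead_coeff (Q l)) (P l)) 1"
      by simp
    then have lc: "lead_coeff (P l) = lead_coeff (Q l)" using Q P by simp
    moreover have "lead_coeff (Q l) \<noteq> 0" using Q(2) by auto
    ultimately show "Q l = P l" using eq by (metis smult_cancel)
  qed
  have "gegenbauer_poly n = (THE P. spec P)"
    unfolding gegenbauer_poly_def spec_def geg_int_def poly_mult ..
  also have "\<dots> = P" by (rule the_equality[of spec, OF specP uniq])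
  finally have "spec (gegenbauer_poly n)" using specP by simp
  then show "degree (gegenbauer_poly n l) = l" "poly (gegenbauer_poly n l) 1 = 1"
    and "l \<noteq> m \<Longrightarrow> geg_int n (gegenbauer_poly n l * gegenbauer_poly n m) = 0"
    unfolding spec_def by blast+
qed

section \<open>Powers of linear forms\<close>

text \<open>The derivative at \<open>0\<close> of a polynomial of degree at most \<open>m\<close> is a fixed combination of its values
  at \<open>0, \<dots>, m\<close>.\<close>
lemma numerical_differentiation:
  "\<exists>\<beta> :: nat \<Rightarrow> real. \<forall>p. degree p \<le> m \<longrightarrow> (\<Sum>i\<le>m. \<beta> i * poly p (real i)) = coeff p 1"
proof -
  have "\<exists>p. degree p = card {..m} - 1 \<and> (\<forall>j\<le>m. poly p (real j) = (if i = j then 1 else 0))"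
    if "i \<le> m" for i
    using lagrange_fundamental_poly[of "real ` {..m}" "real i"] that
    by (auto simp: card_image inj_on_def)
  then have "\<forall>i\<in>{..m}. \<exists>p. degree p = card {..m} - 1 \<and>
      (\<forall>j\<le>m. poly p (real j) = (if i = j then 1 else 0))" by simp
  from bchoice[OF this] obtain l where
    l: "\<forall>i\<in>{..m}. degree (l i) = card {..m} - 1 \<and>
      (\<forall>j\<le>m. poly (l i) (real j) = (if i = j then 1 else 0))" ..
  have "(\<Sum>i\<le>m. coeff (l i) 1 * poly p (real i)) = coeff p 1" if "degree p \<le> m" for p
  proof -
    have "p = (\<Sum>i\<le>m. smult (poly p (real i)) (l i))"
      using that l by (intro lagrange_expansion) (auto simp: inj_on_def)
    then have "coeff p 1 = coeff (\<Sum>i\<le>m. smult (poly p (real i)) (l i)) 1" by simp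
    then show ?thesis by (simp add: coeff_sum mult.commute)
  qed
  then show ?thesis by (intro exI[of _ "\<lambda>i. coeff (l i) 1"]) simp
qed

text \<open>Expanding one factor \<open>v p \<bullet> v q\<close> in an orthonormal basis reduces the quadratic form of the kernel
  \<open>(v p \<bullet> v q)\<^bsup>m+1\<^esup>\<close> to a sum of quadratic forms of the kernel \<open>(v p \<bullet> v q)\<^sup>m\<close> with new
  coefficients. Thus inductions on \<open>m\<close> can take the place of tensor powers.\<close>
lemma power_kernel_Suc:
  fixes v :: "'i \<Rightarrow> 'a :: euclidean_space"
  shows "(\<Sum>p\<in>I. \<Sum>q\<in>I. b p * b q * (v p \<bullet> v q) ^ Suc m)
     = (\<Sum>e\<in>Basis. \<Sum>p\<in>I. \<Sum>q\<in>I. (b p * (v p \<bullet> e)) * (b q * (v q \<bullet> e)) * (v p \<bullet> v q) ^ m)"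
proof -
  have "(\<Sum>p\<in>I. \<Sum>q\<in>I. b p * b q * (v p \<bullet> v q) ^ Suc m)
     = (\<Sum>p\<in>I. \<Sum>q\<in>I. \<Sum>e\<in>Basis. (b p * (v p \<bullet> e)) * (b q * (v q \<bullet> e)) * (v p \<bullet> v q) ^ m)"
    by (intro sum.cong refl)
       (subst power_Suc, subst euclidean_inner, simp add: sum_distrib_left sum_distrib_right mult_ac)
  also have "\<dots> = (\<Sum>p\<in>I. \<Sum>e\<in>Basis. \<Sum>q\<in>I. (b p * (v p \<bullet> e)) * (b q * (v q \<bullet> e)) * (v p \<bullet> v q) ^ m)"
    by (intro sum.cong refl sum.swap)
  also have "\<dots> = (\<Sum>e\<in>Basis. \<Sum>p\<in>I. \<Sum>q\<in>I. (b p * (v p \<bullet> e)) * (b q * (v q \<bullet> e)) * (v p \<bullet> v q) ^ m)"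
    by (rule sum.swap)
  finally show ?thesis .
qed

lemma power_kernel_0: "(\<Sum>p\<in>I. \<Sum>q\<in>I. b p * b q * (v p \<bullet> v q) ^ 0) = (\<Sum>p\<in>I. b p :: real)\<^sup>2"
  by (simp add: power2_eq_square sum_product)

lemma power_kernel_nonneg:
  fixes v :: "'i \<Rightarrow> 'a :: euclidean_space"
  shows "(\<Sum>p\<in>I. \<Sum>q\<in>I. b p * b q * (v p \<bullet> v q) ^ m) \<ge> 0"
proof (induction m arbitrary: b)
  case 0
  show ?case unfolding power_kernel_0 by simp
next
  case (Suc m)
  show ?case unfolding power_kernel_Suc by (intro sum_nonneg Suc)
qed

text \<open>The quadratic form is the squared norm of the tensor \<open>\<Sum> b q (v q)\<^bsup>\<otimes>m\<^esup>\<close>, and the conclusion is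
  its inner product with \<open>z\<^bsup>\<otimes>m\<^esup>\<close>. In the induction step each of the nonnegative
  summands of \<open>power_kernel_Suc\<close> vanishes.\<close>
lemma power_kernel_eq_0:
  fixes v :: "'i \<Rightarrow> 'a :: euclidean_space"
  assumes "(\<Sum>p\<in>I. \<Sum>q\<in>I. b p * b q * (v p \<bullet> v q) ^ m) = 0"
  shows "(\<Sum>q\<in>I. b q * (v q \<bullet> z) ^ m) = 0"
  using assms
proof (induction m arbitrary: b)
  case 0
  then show ?case unfolding power_kernel_0 by simp
next
  case (Suc m)
  have "\<forall>e\<in>Basis. (\<Sum>p\<in>I. \<Sum>q\<in>I. (b p * (v p \<bullet> e)) * (b q * (v q \<bullet> e)) * (v p \<bullet> v q) ^ m) = 0"
    using Suc.prems unfolding power_kernel_Suc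
    by (subst (asm) sum_nonneg_eq_0_iff) (auto intro: power_kernel_nonneg[where b = "\<lambda>p. b p * (v p \<bullet> _)"])
  then have IH: "(\<Sum>q\<in>I. b q * (v q \<bullet> e) * (v q \<bullet> z) ^ m) = 0" if "e \<in> Basis" for e
    using that by (intro Suc.IH[of "\<lambda>q. b q * (v q \<bullet> e)"]) blast
  have "(\<Sum>q\<in>I. b q * (v q \<bullet> z) ^ Suc m)
      = (\<Sum>q\<in>I. \<Sum>e\<in>Basis. (z \<bullet> e) * (b q * (v q \<bullet> e) * (v q \<bullet> z) ^ m))"
    by (intro sum.cong refl)
       (subst power_Suc, subst euclidean_inner, simp add: sum_distrib_left sum_distrib_right mult_ac)
  also have "\<dots> = (\<Sum>e\<in>Basis. (z \<bullet> e) * (\<Sum>q\<in>I. b q * (v q \<bullet> e) * (v q \<bullet> z) ^ m))"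
    by (subst sum.swap) (simp add: sum_distrib_left)
  also have "\<dots> = 0" using IH by simp
  finally show ?case .
qed

definition sum_of_powers :: "nat \<Rightarrow> ('a :: euclidean_space \<Rightarrow> real) \<Rightarrow> bool" where
  "sum_of_powers m f \<longleftrightarrow> (\<exists>xs. \<forall>z. f z = (\<Sum>(a, w)\<leftarrow>xs. a * (w \<bullet> z) ^ m))"

lemma sum_of_powers_single: "sum_of_powers m (\<lambda>z. a * (w \<bullet> z) ^ m)"
  unfolding sum_of_powers_def by (intro exI[of _ "[(a, w)]"]) simp

lemma sum_of_powers_add:
  assumes "sum_of_powers m f" "sum_of_powers m g"
  shows "sum_of_powers m (\<lambda>z. f z + g z)"
proof -
  obtain xs ys where "\<And>z. f z = (\<Sum>(a, w)\<leftarrow>xs. a * (w \<bullet> z) ^ m)"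
    "\<And>z. g z = (\<Sum>(a, w)\<leftarrow>ys. a * (w \<bullet> z) ^ m)"
    using assms unfolding sum_of_powers_def by blast
  then show ?thesis unfolding sum_of_powers_def by (intro exI[of _ "xs @ ys"]) simp
qed

lemma sum_of_powers_sum:
  "(\<And>i. i \<in> A \<Longrightarrow> sum_of_powers m (f i)) \<Longrightarrow> sum_of_powers m (\<lambda>z. \<Sum>i\<in>A. f i z)"
proof (induction A rule: infinite_finite_induct)
  case (insert i A)
  then show ?case by (simp add: sum_of_powers_add)
qed (auto simp: sum_of_powers_def intro!: exI[of _ "[]"])

text \<open>Up to the factor \<open>m + 1\<close>, \<open>(e \<bullet> z) (w \<bullet> z)\<^sup>m\<close> is the derivative at \<open>x = 0\<close> of
  \<open>((w + x e) \<bullet> z)\<^bsup>m+1\<^esup>\<close>, a polynomial in \<open>x\<close>, and numerical differentiation expresses this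
  derivative by finitely many values.\<close>
lemma sum_of_powers_mult_linear:
  assumes "sum_of_powers m f"
  shows "sum_of_powers (Suc m) (\<lambda>z. (e \<bullet> z) * f z)"
proof -
  from numerical_differentiation[of "Suc m"] obtain \<beta> :: "nat \<Rightarrow> real" where
    \<beta>: "\<forall>p. degree p \<le> Suc m \<longrightarrow> (\<Sum>i\<le>Suc m. \<beta> i * poly p (real i)) = coeff p 1" ..
  have one: "sum_of_powers (Suc m) (\<lambda>z. (e \<bullet> z) * (a * (w \<bullet> z) ^ m))" for a w
  proof -
    have "(e \<bullet> z) * (a * (w \<bullet> z) ^ m)
        = (\<Sum>i\<le>Suc m. (a * \<beta> i / Suc m) * ((w + real i *\<^sub>R e) \<bullet> z) ^ Suc m)" for z
    proof -
      define p where "p = [:w \<bullet> z, e \<bullet> z:] ^ Suc m"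
      have "degree p \<le> Suc m" unfolding p_def using degree_power_le[of "[:w \<bullet> z, e \<bullet> z:]" "Suc m"]
        by (simp split: if_splits del: power_Suc)
      then have "(\<Sum>i\<le>Suc m. \<beta> i * poly p (real i)) = coeff p 1" by (rule \<beta>[rule_format])
      also have "coeff p 1 = poly (pderiv p) 0" by (simp add: poly_0_coeff_0 coeff_pderiv)
      also have "\<dots> = Suc m * (w \<bullet> z) ^ m * (e \<bullet> z)"
        unfolding p_def pderiv_power_Suc by (simp add: pderiv_pCons)
      finally have "Suc m * (w \<bullet> z) ^ m * (e \<bullet> z) = (\<Sum>i\<le>Suc m. \<beta> i * poly p (real i))" ..
      moreover have "poly p x = ((w + x *\<^sub>R e) \<bullet> z) ^ Suc m" for x
        unfolding p_def by (simp only: poly_power) (simp add: inner_add_left)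
      ultimately have "Suc m * (w \<bullet> z) ^ m * (e \<bullet> z)
          = (\<Sum>i\<le>Suc m. \<beta> i * ((w + real i *\<^sub>R e) \<bullet> z) ^ Suc m)" by simp
      then have "(a / Suc m) * (Suc m * (w \<bullet> z) ^ m * (e \<bullet> z))
          = (\<Sum>i\<le>Suc m. (a * \<beta> i / Suc m) * ((w + real i *\<^sub>R e) \<bullet> z) ^ Suc m)"
        by (simp add: sum_distrib_left mult.assoc del: of_nat_Suc power_Suc sum.atMost_Suc)
      then show ?thesis by (simp add: mult_ac del: of_nat_Suc power_Suc sum.atMost_Suc)
    qed
    then show ?thesis
      by (simp only:) (intro sum_of_powers_sum sum_of_powers_single)
  qed
  obtain xs where xs: "\<And>z. f z = (\<Sum>(a, w)\<leftarrow>xs. a * (w \<bullet> z) ^ m)"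
    using assms unfolding sum_of_powers_def by blast
  have "sum_of_powers (Suc m) (\<lambda>z. (e \<bullet> z) * (\<Sum>(a, w)\<leftarrow>xs. a * (w \<bullet> z) ^ m))"
  proof (induction xs)
    case Nil
    show ?case using sum_of_powers_single[of "Suc m" 0 e] by simp
  next
    case (Cons y ys)
    then show ?case using sum_of_powers_add[OF one[of "fst y" "snd y"] Cons]
      by (simp add: case_prod_unfold ring_distribs)
  qed
  then show ?thesis by (simp add: xs)
qed

text \<open>A Hilbert identity: \<open>(z \<bullet> z)\<^bsup>j+1\<^esup>\<close> is the sum of \<open>(e \<bullet> z) (e \<bullet> z) (z \<bullet> z)\<^sup>j\<close> over an
  orthonormal basis, and linear factors can be absorbed one at a time.\<close>
lemma sum_of_powers_norm_power:
  "sum_of_powers (2 * j) (\<lambda>z :: 'a :: euclidean_space. (z \<bullet> z) ^ j)"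
proof (induction j)
  case 0
  show ?case using sum_of_powers_single[of 0 1 "0 :: 'a"] by simp
next
  case (Suc j)
  have "sum_of_powers (2 * Suc j) (\<lambda>z :: 'a. \<Sum>e\<in>Basis. (e \<bullet> z) * ((e \<bullet> z) * (z \<bullet> z) ^ j))"
    using Suc by (intro sum_of_powers_sum) (auto intro!: sum_of_powers_mult_linear)
  moreover have "(\<Sum>e\<in>Basis. (e \<bullet> z) * ((e \<bullet> z) * (z \<bullet> z) ^ j)) = (z \<bullet> z) ^ Suc j" for z :: 'a
    unfolding power_Suc by (subst (3) euclidean_inner) (simp add: sum_distrib_right inner_commute mult.assoc)
  ultimately show ?case by simp
qed

text \<open>Both sides result from applying the Laplacian to the assumed identity and dividing by
  \<open>2 (j + 1)\<close>.\<close>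
lemma laplacian_of_power_identity:
  fixes w :: "'i \<Rightarrow> 'a :: euclidean_space"
  assumes "\<And>z. (\<Sum>i\<in>I. a i * (w i \<bullet> z) ^ (2 * j + 2)) = (z \<bullet> z) ^ (j + 1)"
  shows "real (2 * j + 1) * (\<Sum>i\<in>I. a i * (w i \<bullet> w i) * (w i \<bullet> z) ^ (2 * j))
       = real (2 * j + DIM('a)) * (z \<bullet> z) ^ j"
proof -
  \<comment> \<open>The second derivative at \<open>x = 0\<close> along \<open>z + x e\<close>, as an identity of polynomials in \<open>x\<close>.\<close>
  have dir: "2 * (2 * j + 1) * (\<Sum>i\<in>I. a i * (w i \<bullet> z) ^ (2 * j) * ((w i \<bullet> e) * (w i \<bullet> e)))
      = 4 * j * (z \<bullet> z) ^ (j - 1) * ((z \<bullet> e) * (z \<bullet> e)) + 2 * (z \<bullet> z) ^ j"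
    if e: "e \<in> Basis" for e
  proof -
    define P where "P = (\<Sum>i\<in>I. smult (a i) ([:w i \<bullet> z, w i \<bullet> e:] ^ (2 * j + 2)))"
    define R where "R = [:z \<bullet> z, 2 * (z \<bullet> e), 1:] ^ (j + 1)"
    have "poly P x = poly R x" for x
    proof -
      have "poly P x = (\<Sum>i\<in>I. a i * (w i \<bullet> (z + x *\<^sub>R e)) ^ (2 * j + 2))"
        unfolding P_def by (simp only: poly_sum poly_smult poly_power) (simp add: inner_add_right)
      also have "\<dots> = ((z + x *\<^sub>R e) \<bullet> (z + x *\<^sub>R e)) ^ (j + 1)" by (rule assms)
      also have "(z + x *\<^sub>R e) \<bullet> (z + x *\<^sub>R e) = poly [:z \<bullet> z, 2 * (z \<bullet> e), 1:] x"
        using e by (simp add: inner_add_left inner_add_right inner_commute algebra_simps)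
      finally show ?thesis unfolding R_def by (simp only: poly_power)
    qed
    then have PR: "P = R" by (simp add: poly_eq_poly_eq_iff[symmetric] fun_eq_iff)
    have "poly (pderiv (pderiv P)) 0 = (\<Sum>i\<in>I. a i * ((2 * j + 2) * (2 * j + 1) * (w i \<bullet> z) ^ (2 * j) * ((w i \<bullet> e) * (w i \<bullet> e))))"
    proof -
      have "poly (pderiv (pderiv ([:x, y:] ^ (2 * j + 2)))) 0 = (2 * j + 2) * (2 * j + 1) * x ^ (2 * j) * (y * y)"
        for x y :: real
      proof -
        have "pderiv ([:x, y:] ^ (2 * j + 2)) = smult (2 * j + 2) ([:x, y:] ^ Suc (2 * j)) * [:y:]"
          using pderiv_power_Suc[of "[:x, y:]" "Suc (2 * j)"] by (simp add: pderiv_pCons del: power_Suc)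
        then show ?thesis
          by (simp add: pderiv_mult pderiv_smult pderiv_power_Suc pderiv_pCons del: power_Suc)
             (simp add: algebra_simps)
      qed
      then show ?thesis unfolding P_def
        by (simp only: higher_pderiv_sum[of 2, simplified numeral_2_eq_2 funpow.simps o_apply id_apply]
            pderiv_smult poly_sum poly_smult)
    qed
    moreover have "poly (pderiv (pderiv R)) 0 = (j + 1) * (4 * j * (z \<bullet> z) ^ (j - 1) * ((z \<bullet> e) * (z \<bullet> e)) + 2 * (z \<bullet> z) ^ j)"
    proof -
      define r where "r = [:z \<bullet> z, 2 * (z \<bullet> e), 1:]"
      have r: "poly r 0 = z \<bullet> z" "poly (pderiv r) 0 = 2 * (z \<bullet> e)" "poly (pderiv (pderiv r)) 0 = 2"
        unfolding r_def by (simp_all add: pderiv_pCons)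
      have "pderiv (pderiv (r ^ (j + 1))) = smult (j + 1) (pderiv (r ^ j) * pderiv r + r ^ j * pderiv (pderiv r))"
        using pderiv_power_Suc[of r j] by (simp add: pderiv_mult pderiv_smult smult_add_right mult.commute algebra_simps del: power_Suc)
      then show ?thesis unfolding R_def r_def[symmetric]
        by (cases j) (simp_all add: r pderiv_power_Suc algebra_simps del: power_Suc)
    qed
    ultimately have "(\<Sum>i\<in>I. a i * ((2 * j + 2) * (2 * j + 1) * (w i \<bullet> z) ^ (2 * j) * ((w i \<bullet> e) * (w i \<bullet> e))))
      = (j + 1) * (4 * j * (z \<bullet> z) ^ (j - 1) * ((z \<bullet> e) * (z \<bullet> e)) + 2 * (z \<bullet> z) ^ j)"
      using PR by simp
    moreover have "(\<Sum>i\<in>I. a i * ((2 * j + 2) * (2 * j + 1) * (w i \<bullet> z) ^ (2 * j) * ((w i \<bullet> e) * (w i \<bullet> e))))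
      = (j + 1) * (2 * (2 * j + 1) * (\<Sum>i\<in>I. a i * (w i \<bullet> z) ^ (2 * j) * ((w i \<bullet> e) * (w i \<bullet> e))))"
      unfolding sum_distrib_left by (rule sum.cong) (simp_all add: algebra_simps)
    ultimately show ?thesis by simp
  qed
  have "2 * ((2 * j + 1) * (\<Sum>i\<in>I. a i * (w i \<bullet> w i) * (w i \<bullet> z) ^ (2 * j)))
      = (\<Sum>i\<in>I. \<Sum>e\<in>Basis. 2 * (2 * j + 1) * (a i * (w i \<bullet> z) ^ (2 * j) * ((w i \<bullet> e) * (w i \<bullet> e))))"
    unfolding sum_distrib_left
    by (intro sum.cong refl, subst euclidean_inner[of "w _" "w _"])
       (simp add: sum_distrib_left sum_distrib_right algebra_simps)
  also have "\<dots> = (\<Sum>e\<in>Basis. 2 * (2 * j + 1) * (\<Sum>i\<in>I. a i * (w i \<bullet> z) ^ (2 * j) * ((w i \<bullet> e) * (w i \<bullet> e))))"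
    by (subst sum.swap) (simp add: sum_distrib_left)
  also have "\<dots> = (\<Sum>e\<in>Basis. 4 * j * (z \<bullet> z) ^ (j - 1) * ((z \<bullet> e) * (z \<bullet> e)) + 2 * (z \<bullet> z) ^ j)"
    by (intro sum.cong refl dir)
  also have "\<dots> = 4 * j * (z \<bullet> z) ^ (j - 1) * (z \<bullet> z) + 2 * DIM('a) * (z \<bullet> z) ^ j"
    by (subst (4) euclidean_inner) (simp add: sum.distrib sum_distrib_left)
  also have "\<dots> = 2 * ((2 * j + DIM('a)) * (z \<bullet> z) ^ j)"
    by (cases j) (simp_all add: algebra_simps)
  finally show ?thesis by simp
qed

text \<open>Applying the Laplacian \<open>j\<close> times turns the identity into one between constants. The hypotheses
  on \<open>c\<close> are the recursion satisfied by the even moments of the Gegenbauer measure; this is where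
  that measure meets the geometry of the sphere.\<close>
lemma power_identity_mass:
  fixes w :: "'i \<Rightarrow> 'a :: euclidean_space" and c :: "nat \<Rightarrow> real"
  assumes "\<And>z. (\<Sum>i\<in>I. a i * (w i \<bullet> z) ^ (2 * j)) = (z \<bullet> z) ^ j"
    and c: "c 0 = 1" "\<And>j. real (2 * j + DIM('a)) * c (Suc j) = real (2 * j + 1) * c j"
  shows "c j * (\<Sum>i\<in>I. a i * (w i \<bullet> w i) ^ j) = 1"
  using assms(1)
proof (induction j arbitrary: a)
  case 0
  then show ?case using c(1) by simp
next
  case (Suc j)
  define \<kappa> where "\<kappa> = (2 * j + 1) / (2 * j + DIM('a))"
  have "real (2 * j + DIM('a)) > 0" by (simp add: add_nonneg_pos)
  then have cs: "c (Suc j) = \<kappa> * c j" using c(2)[of j] by (simp add: \<kappa>_def field_simps)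
  have lap: "real (2 * j + 1) * (\<Sum>i\<in>I. a i * (w i \<bullet> w i) * (w i \<bullet> z) ^ (2 * j))
       = real (2 * j + DIM('a)) * (z \<bullet> z) ^ j" for z
    by (rule laplacian_of_power_identity) (use Suc.prems in simp)
  have "(\<Sum>i\<in>I. \<kappa> * (a i * (w i \<bullet> w i)) * (w i \<bullet> z) ^ (2 * j)) = (z \<bullet> z) ^ j" for z
  proof -
    have "(\<Sum>i\<in>I. \<kappa> * (a i * (w i \<bullet> w i)) * (w i \<bullet> z) ^ (2 * j))
        = \<kappa> * (\<Sum>i\<in>I. a i * (w i \<bullet> w i) * (w i \<bullet> z) ^ (2 * j))"
      by (simp add: sum_distrib_left mult.assoc)
    also have "\<dots> = (z \<bullet> z) ^ j"
      using lap[of z] \<open>real (2 * j + DIM('a)) > 0\<close> by (simp add: \<kappa>_def field_simps)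
    finally show ?thesis .
  qed
  from Suc.IH[OF this] have "c j * (\<Sum>i\<in>I. \<kappa> * (a i * (w i \<bullet> w i)) * (w i \<bullet> w i) ^ j) = 1" .
  then show ?case unfolding cs by (simp add: sum_distrib_left mult_ac)
qed

text \<open>Think of \<open>N = card C\<close> unit masses on \<open>C\<close>, minus the masses \<open>N c\<^sub>j a\<^sub>i\<close> at the points \<open>w\<^sub>i\<close> of a
  Hilbert identity. The energy of this signed mass distribution for the kernel
  \<open>(x \<bullet> y)\<^bsup>2j\<^esup>\<close> is \<open>N\<^sup>2 c\<^sub>j - 2 N\<^sup>2 c\<^sub>j + N\<^sup>2 c\<^sub>j = 0\<close>, hence so is its potential.\<close>
lemma sidelnikov_equality:
  fixes C :: "'a :: euclidean_space set" and c :: "nat \<Rightarrow> real"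
  assumes C: "finite C" "C \<subseteq> sphere 0 1"
    and c: "c 0 = 1" "\<And>j. real (2 * j + DIM('a)) * c (Suc j) = real (2 * j + 1) * c j"
    and eq: "(\<Sum>x\<in>C. \<Sum>y\<in>C. (x \<bullet> y) ^ (2 * j)) = (card C)\<^sup>2 * c j"
  shows "(\<Sum>y\<in>C. (y \<bullet> z) ^ (2 * j)) = card C * c j * (z \<bullet> z) ^ j"
proof -
  obtain xs :: "(real \<times> 'a) list" where
    xs: "\<And>z. (z \<bullet> z) ^ j = (\<Sum>(a, w)\<leftarrow>xs. a * (w \<bullet> z) ^ (2 * j))"
    using sum_of_powers_norm_power[of j, where ?'a = 'a] unfolding sum_of_powers_def by blast
  define J where "J = {..<length xs}"
  define a where "a i = fst (xs ! i)" for i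
  define w where "w i = snd (xs ! i)" for i
  have aw: "(\<Sum>i\<in>J. a i * (w i \<bullet> z) ^ (2 * j)) = (z \<bullet> z) ^ j" for z
    unfolding xs by (simp add: sum_list_sum_nth J_def a_def w_def case_prod_unfold atLeast0LessThan)
  have mass: "c j * (\<Sum>i\<in>J. a i * (w i \<bullet> w i) ^ j) = 1"
    by (rule power_identity_mass[OF aw c])
  define N where "N = real (card C)"
  define I where "I = C <+> J"
  define v :: "'a + nat \<Rightarrow> 'a" where "v = case_sum (\<lambda>x. x) w"
  define b :: "'a + nat \<Rightarrow> real" where "b = case_sum (\<lambda>x. 1) (\<lambda>i. - (N * c j) * a i)"
  have finJ: "finite J" unfolding J_def by simp
  have split: "(\<Sum>p\<in>I. b p * f (v p)) = (\<Sum>x\<in>C. f x) - N * c j * (\<Sum>i\<in>J. a i * f (w i))" for f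
    unfolding I_def using C(1) finJ
    by (simp add: sum.Plus b_def v_def sum_distrib_left sum_negf mult.assoc)
  have R: "(\<Sum>q\<in>I. b q * (v q \<bullet> z) ^ (2 * j)) = (\<Sum>y\<in>C. (y \<bullet> z) ^ (2 * j)) - N * c j * (z \<bullet> z) ^ j" for z
    using split[of "\<lambda>x. (x \<bullet> z) ^ (2 * j)"] by (simp add: aw)
  have unit: "x \<bullet> x = 1" if "x \<in> C" for x
    using that C(2) by (auto simp: norm_eq_1)
  have "(\<Sum>p\<in>I. \<Sum>q\<in>I. b p * b q * (v p \<bullet> v q) ^ (2 * j))
      = (\<Sum>p\<in>I. b p * ((\<Sum>y\<in>C. (y \<bullet> v p) ^ (2 * j)) - N * c j * (v p \<bullet> v p) ^ j))"
    unfolding R[symmetric] by (simp add: sum_distrib_left mult.assoc inner_commute)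
  also have "\<dots> = (\<Sum>x\<in>C. (\<Sum>y\<in>C. (y \<bullet> x) ^ (2 * j)) - N * c j * (x \<bullet> x) ^ j)
      - N * c j * (\<Sum>i\<in>J. a i * ((\<Sum>y\<in>C. (y \<bullet> w i) ^ (2 * j)) - N * c j * (w i \<bullet> w i) ^ j))"
    by (rule split)
  also have "(\<Sum>x\<in>C. (\<Sum>y\<in>C. (y \<bullet> x) ^ (2 * j)) - N * c j * (x \<bullet> x) ^ j) = 0"
    using eq by (simp add: sum_subtractf unit inner_commute N_def power2_eq_square)
  also have "(\<Sum>i\<in>J. a i * ((\<Sum>y\<in>C. (y \<bullet> w i) ^ (2 * j)) - N * c j * (w i \<bullet> w i) ^ j)) = 0"
  proof -
    have "(\<Sum>i\<in>J. a i * (\<Sum>y\<in>C. (y \<bullet> w i) ^ (2 * j))) = (\<Sum>y\<in>C. \<Sum>i\<in>J. a i * (w i \<bullet> y) ^ (2 * j))"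
      by (subst sum.swap) (simp add: sum_distrib_left inner_commute)
    also have "\<dots> = N" by (simp add: aw unit N_def)
    also have "N = N * (c j * (\<Sum>i\<in>J. a i * (w i \<bullet> w i) ^ j))" by (simp add: mass)
    finally show ?thesis
      by (simp add: right_diff_distrib sum_subtractf sum_distrib_left mult_ac)
  qed
  finally have "(\<Sum>p\<in>I. \<Sum>q\<in>I. b p * b q * (v p \<bullet> v q) ^ (2 * j)) = 0" by simp
  then have "(\<Sum>q\<in>I. b q * (v q \<bullet> z) ^ (2 * j)) = 0" by (rule power_kernel_eq_0)
  then show ?thesis unfolding R N_def by simp
qed

section \<open>Designs as cubature formulas\<close>

lemma gegenbauer_poly_orthogonal_below:
  assumes n: "n \<ge> 2" and p: "degree p < l"
  shows "geg_int n (gegenbauer_poly n l * p) = 0"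
proof -
  interpret poly_functional "geg_int n" using n by (rule geg_int_poly_functional)
  have "gegenbauer_poly n i \<noteq> 0" for i
    using gegenbauer_poly_spec(2)[OF n, of i] by auto
  then have "orthogonal_below l (gegenbauer_poly n l)"
    using gegenbauer_poly_spec[OF n] by (intro orthogonal_to_span[where P = "gegenbauer_poly n"]) auto
  then show ?thesis using p by (rule orthogonal_belowD)
qed

lemma gegenbauer_poly_parity:
  assumes n: "n \<ge> 2"
  shows "poly (gegenbauer_poly n l) (- t) = (-1) ^ l * poly (gegenbauer_poly n l) t"
proof -
  interpret poly_functional "geg_int n" using n by (rule geg_int_poly_functional)
  show ?thesis
  proof (rule orthogonal_poly_parity)
    show "orthogonal_below l (gegenbauer_poly n l)"
      unfolding orthogonal_below_def using gegenbauer_poly_orthogonal_below[OF n] by blast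
    show "geg_int n (p\<^sup>2) > 0" if "p \<noteq> 0" for p using that by (intro geg_int_pos[OF n]) auto
  qed (use gegenbauer_poly_spec[OF n] geg_int_reflect[OF n] in auto)
qed

text \<open>Induction on the degree: subtracting a multiple of the Gegenbauer polynomial \<open>P\<close> of the same
  degree lowers the degree, and \<open>P\<close> contributes nothing to either side. For odd degree this is
  parity, for even degree it is the design equation.\<close>
lemma design_pair_average:
  fixes C :: "(real ^ 'n) set"
  assumes n: "CARD('n) \<ge> 2" and C: "kk_design k C" and f: "degree f \<le> 2 * k + 1"
  shows "(\<Sum>x\<in>C. \<Sum>y\<in>C. poly f (x \<bullet> y) + poly f (- (x \<bullet> y))) = 2 * (card C)\<^sup>2 * geg_int CARD('n) f"
  using f
proof (induction "degree f" arbitrary: f rule: less_induct)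
  case less
  let ?n = "CARD('n)"
  interpret poly_functional "geg_int ?n" using n by (rule geg_int_poly_functional)
  define l where "l = degree f"
  show ?case
  proof (cases "l = 0")
    case True
    then obtain c where f: "f = [:c:]" unfolding l_def by (auto elim: degree_eq_zeroE)
    have "geg_int ?n [:c:] = c" using smult[of c 1] geg_int_1[OF n] by simp
    then show ?thesis unfolding f by (simp add: power2_eq_square)
  next
    case False
    define P where "P = gegenbauer_poly ?n l"
    have P: "degree P = l" unfolding P_def by (rule gegenbauer_poly_spec[OF n])
    have P0: "coeff P l \<noteq> 0" using P False by (metis degree_0 leading_coeff_0_iff)
    define c where "c = coeff f l / coeff P l"
    define f' where "f' = f - smult c P"
    have "coeff f' l = 0" unfolding f'_def c_def using P0 by simp
    moreover have "degree f' \<le> l" unfolding f'_def using P by (intro degree_diff_le) (auto simp: l_def)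
    ultimately have deg: "degree f' < l" using False by (metis degree_0 le_neq_implies_less leading_coeff_0_iff neq0_conv)
    have IH: "(\<Sum>x\<in>C. \<Sum>y\<in>C. poly f' (x \<bullet> y) + poly f' (- (x \<bullet> y))) = 2 * (card C)\<^sup>2 * geg_int ?n f'"
      using deg less.prems unfolding l_def by (intro less.hyps) auto
    have f: "f = f' + smult c P" unfolding f'_def by simp
    have gP: "geg_int ?n P = 0"
      using gegenbauer_poly_orthogonal_below[OF n, of 1 l] False unfolding P_def by simp
    have sP: "(\<Sum>x\<in>C. \<Sum>y\<in>C. poly P (x \<bullet> y) + poly P (- (x \<bullet> y))) = 0"
    proof (cases "even l")
      case True
      then have "l \<in> {2..2 * k}" using False less.prems unfolding l_def[symmetric] by auto
      then have "(\<Sum>x\<in>C. \<Sum>y\<in>C. poly P (x \<bullet> y)) = 0"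
        using C True unfolding kk_design_def P_def by blast
      then show ?thesis
        using True unfolding P_def gegenbauer_poly_parity[OF n] by (simp add: sum_distrib_left[symmetric])
    next
      case False
      then show ?thesis unfolding P_def gegenbauer_poly_parity[OF n] by simp
    qed
    have "(\<Sum>x\<in>C. \<Sum>y\<in>C. poly f (x \<bullet> y) + poly f (- (x \<bullet> y)))
        = (\<Sum>x\<in>C. \<Sum>y\<in>C. poly f' (x \<bullet> y) + poly f' (- (x \<bullet> y)))
          + c * (\<Sum>x\<in>C. \<Sum>y\<in>C. poly P (x \<bullet> y) + poly P (- (x \<bullet> y)))"
      unfolding f by (simp add: sum.distrib sum_distrib_left algebra_simps)
    then show ?thesis unfolding sP IH unfolding f by (simp add: add smult gP)
  qed
qed

lemma design_even_moment:
  fixes C :: "(real ^ 'n) set"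
  assumes n: "CARD('n) \<ge> 2" and C: "kk_design k C" and j: "j \<le> k" and z: "norm z = 1"
  shows "(\<Sum>y\<in>C. (z \<bullet> y) ^ (2 * j)) = card C * geg_int CARD('n) (monom 1 (2 * j))"
proof -
  let ?c = "\<lambda>j. geg_int CARD('n) (monom 1 (2 * j))"
  have code: "finite C" "C \<subseteq> sphere 0 1"
    using C unfolding kk_design_def spherical_code_def by auto
  have "2 * (\<Sum>x\<in>C. \<Sum>y\<in>C. (x \<bullet> y) ^ (2 * j)) = 2 * ((card C)\<^sup>2 * ?c j)"
    using design_pair_average[OF n C, of "monom 1 (2 * j)"] j
    by (simp add: poly_monom degree_monom_eq sum_distrib_left)
  then have eq: "(\<Sum>x\<in>C. \<Sum>y\<in>C. (x \<bullet> y) ^ (2 * j)) = (card C)\<^sup>2 * ?c j" by simp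
  have c: "?c 0 = 1" "\<And>j. real (2 * j + DIM(real ^ 'n)) * ?c (Suc j) = real (2 * j + 1) * ?c j"
    using geg_int_1[OF n] geg_int_even_power_rec[OF n] by simp_all
  have "(\<Sum>y\<in>C. (y \<bullet> z) ^ (2 * j)) = card C * ?c j * (z \<bullet> z) ^ j"
    by (rule sidelnikov_equality[where c = ?c, OF code c eq])
  moreover have "z \<bullet> z = 1" using z by (simp add: norm_eq_1)
  ultimately show ?thesis by (simp add: inner_commute)
qed

text \<open>The passage from pairs of design points to a single design point and an arbitrary point \<open>z\<close> of
  the sphere. The symmetrization removes the odd powers, on which a \<open>(k,k)\<close>-design
  gives no information.\<close>
lemma design_cubature:
  fixes C :: "(real ^ 'n) set"
  assumes n: "CARD('n) \<ge> 2" and C: "kk_design k C" and f: "degree f \<le> 2 * k + 1" and z: "norm z = 1"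
  shows "(\<Sum>y\<in>C. poly f (z \<bullet> y) + poly f (- (z \<bullet> y))) = 2 * card C * geg_int CARD('n) f"
proof -
  interpret poly_functional "geg_int CARD('n)" using n by (rule geg_int_poly_functional)
  have mono: "(\<Sum>y\<in>C. (z \<bullet> y) ^ i + (- (z \<bullet> y)) ^ i) = 2 * card C * geg_int CARD('n) (monom 1 i)"
    if "i \<le> degree f" for i
  proof (cases "even i")
    case True
    then obtain j where j: "i = 2 * j" by blast
    then have "j \<le> k" using that f by linarith
    then show ?thesis using design_even_moment[OF n C _ z, of j] j
      by (simp add: sum_distrib_left[symmetric])
  next
    case False
    then show ?thesis by (simp add: geg_int_odd_power[OF n])
  qed
  have "(\<Sum>y\<in>C. poly f (z \<bullet> y) + poly f (- (z \<bullet> y)))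
      = (\<Sum>y\<in>C. \<Sum>i\<le>degree f. coeff f i * ((z \<bullet> y) ^ i + (- (z \<bullet> y)) ^ i))"
    by (simp add: poly_altdef sum.distrib[symmetric] distrib_left)
  also have "\<dots> = (\<Sum>i\<le>degree f. coeff f i * (\<Sum>y\<in>C. (z \<bullet> y) ^ i + (- (z \<bullet> y)) ^ i))"
    by (subst sum.swap) (simp add: sum_distrib_left)
  also have "\<dots> = (\<Sum>i\<le>degree f. coeff f i * (2 * card C * geg_int CARD('n) (monom 1 i)))"
    by (intro sum.cong refl) (simp add: mono)
  also have "\<dots> = 2 * card C * (\<Sum>i\<le>degree f. geg_int CARD('n) (smult (coeff f i) (monom 1 i)))"
    by (simp add: sum_distrib_left smult mult_ac)
  also have "(\<Sum>i\<le>degree f. geg_int CARD('n) (smult (coeff f i) (monom 1 i))) = geg_int CARD('n) f"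
    unfolding sum[symmetric] by (simp add: smult_monom poly_as_sum_of_monoms)
  finally show ?thesis .
qed

section \<open>The orthogonal polynomial with a signed weight\<close>

text \<open>Integration of polynomials against \<open>\<nu>\<^sub>s\<close>, with the factor \<open>s\<^sup>2 - t\<^sup>2\<close> moved into the integrand.\<close>
definition nu_functional :: "nat \<Rightarrow> real \<Rightarrow> real poly \<Rightarrow> real" where
  "nu_functional n s p = geg_int n (p * [:s\<^sup>2, 0, -1:])"

lemma nu_functional_poly_functional:
  assumes "n \<ge> 2"
  shows "poly_functional (nu_functional n s)"
proof -
  interpret L: poly_functional "geg_int n" using assms by (rule geg_int_poly_functional)
  show ?thesis
    by unfold_locales (simp_all add: nu_functional_def distrib_right L.add L.smult del: mult_pCons_right)
qed

lemma nu_functional_reflect: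
  assumes "n \<ge> 2"
  shows "nu_functional n s (pcompose p [:0, -1:]) = nu_functional n s p"
proof -
  have "pcompose (p * [:s\<^sup>2, 0, -1:]) [:0, -1:] = pcompose p [:0, -1:] * [:s\<^sup>2, 0, -1:]"
    by (simp add: pcompose_mult pcompose_pCons del: mult_pCons_right)
  then show ?thesis unfolding nu_functional_def using geg_int_reflect[OF assms] by metis
qed

text \<open>By the cubature property, the functional is on these polynomials, up to the factor \<open>2 card C\<close>,
  a sum over the points
  \<open>\<plusminus> (x \<bullet> y)\<close> of \<open>(-s, s)\<close> with positive weights \<open>s\<^sup>2 - (x \<bullet> y)\<^sup>2\<close>, hence nonnegative. It cannot
  be zero: otherwise \<open>r\<close> would vanish at all these points, and a second use of the cubature
  property would make the integral of \<open>r\<^sup>2\<close> zero.\<close>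
lemma nu_functional_pos:
  fixes C :: "(real ^ 'n) set"
  assumes n: "CARD('n) \<ge> 2" and C: "kk_design k C"
    and x: "norm x = 1" "\<And>y. y \<in> C \<Longrightarrow> \<bar>x \<bullet> y\<bar> < s"
    and r: "r \<noteq> 0" "degree r < k" and deg: "degree (r\<^sup>2 * g) < 2 * k"
    and g: "\<And>t. t \<in> {-s<..<s} \<Longrightarrow> poly g t > 0"
  shows "nu_functional CARD('n) s (r\<^sup>2 * g) > 0"
proof (rule ccontr)
  let ?n = "CARD('n)"
  assume "\<not> ?thesis"
  then have le: "nu_functional ?n s (r\<^sup>2 * g) \<le> 0" by simp
  have code: "finite C" "C \<noteq> {}" using C unfolding kk_design_def spherical_code_def by auto
  have pts: "x \<bullet> y \<in> {-s<..<s}" "- (x \<bullet> y) \<in> {-s<..<s}" "s\<^sup>2 - (x \<bullet> y)\<^sup>2 > 0" if "y \<in> C" for y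
    using x(2)[OF that] power_strict_mono[OF x(2)[OF that], of 2] by (auto simp: abs_less_iff)
  let ?T = "\<lambda>y. (poly (r\<^sup>2 * g) (x \<bullet> y) + poly (r\<^sup>2 * g) (- (x \<bullet> y))) * (s\<^sup>2 - (x \<bullet> y)\<^sup>2)"
  have "degree ((r\<^sup>2 * g) * [:s\<^sup>2, 0, -1:]) \<le> 2 * k + 1"
    using degree_mult_le[of "r\<^sup>2 * g" "[:s\<^sup>2, 0, -1:]"] deg by simp
  from design_cubature[OF n C this x(1)]
  have "(\<Sum>y\<in>C. ?T y) = 2 * card C * nu_functional ?n s (r\<^sup>2 * g)"
    unfolding nu_functional_def poly_mult by (simp add: power2_eq_square algebra_simps)
  then have sum: "(\<Sum>y\<in>C. ?T y) \<le> 0" using le by (simp add: mult_nonneg_nonpos)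
  have nn: "?T y \<ge> 0" if "y \<in> C" for y
    using pts[OF that] g by (auto intro!: mult_nonneg_nonneg add_nonneg_nonneg intro: less_imp_le)
  have "\<forall>y\<in>C. ?T y = 0"
    using sum_nonneg_eq_0_iff[OF code(1), of ?T] nn order_antisym[OF sum sum_nonneg[of C ?T]] by blast
  then have zero: "poly r (x \<bullet> y) = 0 \<and> poly r (- (x \<bullet> y)) = 0" if y: "y \<in> C" for y
  proof -
    have "poly g (x \<bullet> y) > 0" "poly g (- (x \<bullet> y)) > 0" using g pts[OF y] by auto
    moreover have "poly (r\<^sup>2 * g) (x \<bullet> y) + poly (r\<^sup>2 * g) (- (x \<bullet> y)) = 0"
      using \<open>\<forall>y\<in>C. ?T y = 0\<close> pts[OF y] y by auto
    ultimately show ?thesis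
      by (simp add: add_nonneg_eq_0_iff)
  qed
  have "degree (r\<^sup>2) \<le> 2 * k + 1" using degree_power_le[of r 2] r(2) by simp
  from design_cubature[OF n C this x(1)]
  have "2 * card C * geg_int ?n (r\<^sup>2) = 0" using zero by simp
  moreover have "geg_int ?n (r\<^sup>2) > 0" using r(1) by (intro geg_int_pos[OF n]) auto
  ultimately show False using code by simp
qed

lemma is_q_poly_iff:
  assumes "n \<ge> 2"
  shows "is_q_poly n k s q \<longleftrightarrow> q \<noteq> 0 \<and> degree q = k \<and>
           poly_functional.orthogonal_below (nu_functional n s) k q"
proof -
  interpret poly_functional "nu_functional n s" using assms by (rule nu_functional_poly_functional)
  have "nu_integral n s (\<lambda>t. poly q t * poly p t) = nu_functional n s (q * p)" for p
  proof -
    have "poly (q * p) = (\<lambda>t. poly q t * poly p t)" by (simp add: fun_eq_iff)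
    then show ?thesis
      using nu_integral_eq[OF assms, of s "q * p"] unfolding nu_functional_def by simp
  qed
  then show ?thesis unfolding is_q_poly_def orthogonal_below_def by simp
qed

text \<open>The conclusions hold for every polynomial that satisfies \<^const>\<open>is_q_poly\<close>, in particular for the
  chosen one. Evenness of the functional gives the symmetry of the zeros.\<close>
lemma q_poly_roots:
  fixes C :: "(real ^ 'n) set"
  assumes n: "CARD('n) \<ge> 2" and C: "kk_design k C"
    and x: "norm x = 1" "\<And>y. y \<in> C \<Longrightarrow> \<bar>x \<bullet> y\<bar> < s"
  defines "q \<equiv> q_poly CARD('n) k s"
  shows "is_q_poly CARD('n) k s q"
    and "card {t. poly q t = 0} = k" "{t. poly q t = 0} \<subseteq> {-s<..<s}"
    and "poly q t = 0 \<Longrightarrow> poly q (- t) = 0"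
proof -
  interpret poly_functional "nu_functional CARD('n) s" using n by (rule nu_functional_poly_functional)
  note pos = nu_functional_pos[OF n C x]
  have sq: "nu_functional CARD('n) s (p\<^sup>2) > 0" if "p \<noteq> 0" "degree p < k" for p
  proof -
    have "degree (p\<^sup>2 * 1) < 2 * k" using degree_power_le[of p 2] that by simp
    then show ?thesis using pos[of p 1] that by simp
  qed
  obtain q0 where "degree q0 = k" "lead_coeff q0 = 1" "orthogonal_below k q0"
    using orthogonal_poly_exists[OF sq, of k] by auto
  then have "is_q_poly CARD('n) k s q0" unfolding is_q_poly_iff[OF n] by auto
  then show q: "is_q_poly CARD('n) k s q"
    unfolding q_def q_poly_def by (rule someI)
  then have q': "q \<noteq> 0" "degree q = k" "orthogonal_below k q" unfolding is_q_poly_iff[OF n] by auto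
  have "card {t. poly q t = 0} = k \<and> {t. poly q t = 0} \<subseteq> {-s<..<s}"
    by (rule orthogonal_poly_roots[OF pos q'])
  then show "card {t. poly q t = 0} = k" "{t. poly q t = 0} \<subseteq> {-s<..<s}" by auto
  show "poly q (- t) = 0" if "poly q t = 0"
    using orthogonal_poly_parity[OF sq nu_functional_reflect[OF n] q'(2,3), of t] that by simp
qed

section \<open>The quadrature rule\<close>

lemma node_values:
  defines "A n k s \<equiv> {t. poly (q_poly n k s) t = 0}"
  assumes A: "card (A n k s) = k" "A n k s \<subseteq> {-s<..<s}" "finite (A n k s)" and s: "s > 0"
  shows "node n k s ` {1..k} = A n k s" "inj_on (node n k s) {0..k + 1}"
    and "node n k s 0 = - s" "node n k s (k + 1) = s"
proof -
  let ?xs = "sorted_list_of_set (A n k s)"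
  have xs: "length ?xs = k" "set ?xs = A n k s" "distinct ?xs" using A by auto
  have inner: "node n k s i = ?xs ! (i - 1)" if "i \<in> {1..k}" for i
    using that unfolding node_def A_def by auto
  show ends: "node n k s 0 = - s" "node n k s (k + 1) = s" unfolding node_def by auto
  have "node n k s ` {1..k} = (\<lambda>i. ?xs ! (i - 1)) ` {1..k}"
    by (intro image_cong refl inner)
  also have "\<dots> = (\<lambda>i. ?xs ! i) ` {..<k}"
    by (force simp: image_iff intro: bexI[of _ "Suc _"])
  also have "\<dots> = set ?xs" unfolding set_conv_nth using xs(1) by auto
  also have "\<dots> = A n k s" by (rule xs(2))
  finally show im: "node n k s ` {1..k} = A n k s" .
  have inj1: "inj_on (node n k s) {1..k}"
    by (rule eq_card_imp_inj_on, simp, subst im, simp add: A(1))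
  have "{0..k + 1} = insert 0 (insert (k + 1) {1..k})" by auto
  moreover have "s \<notin> A n k s" "- s \<notin> A n k s" using A(2) by auto
  ultimately show "inj_on (node n k s) {0..k + 1}"
    using inj1 im ends s by (simp add: inj_on_insert)
qed

lemma lagrange_poly_spec:
  assumes "inj_on z {0..m}" "i \<le> m"
  shows "degree (lagrange_poly m z i) = m"
    and "j \<le> m \<Longrightarrow> poly (lagrange_poly m z i) (z j) = (if i = j then 1 else 0)"
proof -
  let ?P = "\<lambda>p. degree p = m \<and> (\<forall>j\<le>m. poly p (z j) = (if i = j then 1 else 0))"
  have card: "card (z ` {0..m}) = Suc m" using assms(1) by (simp add: card_image)
  have ex: "\<exists>p. ?P p"
  proof -
    obtain p where p: "degree p = m" "\<forall>y\<in>z ` {0..m}. poly p y = (if y = z i then 1 else 0)"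
      using lagrange_fundamental_poly[of "z ` {0..m}" "z i"] assms card by auto
    have "poly p (z j) = (if i = j then 1 else 0)" if "j \<le> m" for j
      using p(2) that assms inj_onD[OF assms(1), of j i] by auto
    then show ?thesis using p(1) by blast
  qed
  have "p = p'" if "?P p" "?P p'" for p p'
    using that card by (intro poly_eqI_degree[of "z ` {0..m}"]) auto
  then have "\<exists>!p. ?P p" using ex by blast
  from theI'[OF this] show "degree (lagrange_poly m z i) = m"
    and "j \<le> m \<Longrightarrow> poly (lagrange_poly m z i) (z j) = (if i = j then 1 else 0)"
    unfolding lagrange_poly_def by blast+
qed

text \<open>As for Gauss quadrature: divide \<open>f\<close> by the nodal polynomial \<open>(s\<^sup>2 - t\<^sup>2) q\<close>, of degree \<open>k + 2\<close>. The
  quotient has degree below \<open>k\<close>, so its product with the nodal polynomial integrates to zero, and the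
  remainder equals its Lagrange interpolant.\<close>
lemma quadrature:
  assumes n: "n \<ge> 2" and q: "is_q_poly n k s (q_poly n k s)"
    and roots: "card {t. poly (q_poly n k s) t = 0} = k" "{t. poly (q_poly n k s) t = 0} \<subseteq> {-s<..<s}"
    and s: "s > 0" and f: "degree f \<le> 2 * k + 1"
  shows "geg_int n f = (\<Sum>i=0..k + 1. quad_weight n k s i * poly f (node n k s i))"
proof -
  interpret L: poly_functional "geg_int n" using n by (rule geg_int_poly_functional)
  interpret nu: poly_functional "nu_functional n s" using n by (rule nu_functional_poly_functional)
  define Q where "Q = q_poly n k s"
  have Q: "Q \<noteq> 0" "degree Q = k" "nu.orthogonal_below k Q"
    using q unfolding Q_def is_q_poly_iff[OF n] by auto
  let ?z = "node n k s"
  note nodes = node_values[OF roots poly_roots_finite[OF Q(1)[unfolded Q_def]] s, folded Q_def]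
  define D where "D = Q * [:s\<^sup>2, 0, -1:]"
  have degD: "degree D = k + 2" unfolding D_def using Q by (subst degree_mult_eq) auto
  then have D0: "D \<noteq> 0" by auto
  define r where "r = f mod D"
  have fr: "f = D * (f div D) + r" unfolding r_def by simp
  have degr: "degree r < k + 2"
    unfolding r_def using degree_mod_less[OF D0, of f] degD by auto
  have Dz: "poly D (?z i) = 0" if i: "i \<in> {0..k + 1}" for i
  proof -
    consider "i = 0" | "i \<in> {1..k}" | "i = k + 1" using i by force
    then show ?thesis
    proof cases
      case 2
      then have "poly Q (?z i) = 0" using nodes(1) by blast
      then show ?thesis unfolding D_def by simp
    qed (simp_all add: D_def nodes(3) nodes(4)[simplified] power2_eq_square)
  qed
  have "geg_int n (D * (f div D)) = 0"
  proof (cases "f div D = 0")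
    case True
    then show ?thesis by (simp add: L.zero)
  next
    case False
    then have deg: "degree (D * (f div D)) = degree D + degree (f div D)"
      using D0 by (simp add: degree_mult_eq)
    then have "degree f = degree (D * (f div D))"
      using degree_add_eq_left[of r "D * (f div D)"] degr degD arg_cong[OF fr, of degree] by simp
    then have "degree D + degree (f div D) \<le> 2 * k + 1" using deg f by simp
    then have "degree (f div D) < k" using degD by simp
    then have "nu_functional n s (Q * (f div D)) = 0" using nu.orthogonal_belowD Q(3) by blast
    then show ?thesis unfolding nu_functional_def D_def by (simp only: mult_ac)
  qed
  then have "geg_int n f = geg_int n r" using fr L.add by (metis add_0)
  also have "r = (\<Sum>i=0..k + 1. smult (poly r (?z i)) (lagrange_poly (k + 1) ?z i))"
    using nodes(2) degr lagrange_poly_spec[OF nodes(2)]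
    by (intro lagrange_expansion) auto
  also have "geg_int n \<dots> = (\<Sum>i=0..k + 1. quad_weight n k s i * poly r (?z i))"
    unfolding L.sum L.smult quad_weight_def geg_int_def[symmetric] by (simp add: mult.commute)
  also have "\<dots> = (\<Sum>i=0..k + 1. quad_weight n k s i * poly f (?z i))"
  proof (intro sum.cong refl)
    fix i assume "i \<in> {0..k + 1}"
    from Dz[OF this] have "poly f (?z i) = poly r (?z i)"
      by (subst fr) simp
    then show "quad_weight n k s i * poly r (?z i) = quad_weight n k s i * poly f (?z i)" by simp
  qed
  finally show ?thesis .
qed

section \<open>The covering radius and the universal bound\<close>

text \<open>Counts the interpolation conditions at the squares of the inner nodes: two for each positive
  node, one for the node \<open>0\<close>.\<close>
lemma symmetric_set_card:
  fixes A :: "real set"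
  assumes "finite A" "\<And>t. t \<in> A \<Longrightarrow> - t \<in> A"
  shows "card A = card (A \<inter> {0}) + 2 * card ((\<lambda>t. t\<^sup>2) ` (A \<inter> {0<..}))"
proof -
  let ?P = "A \<inter> {0<..}"
  have sq: "card ((\<lambda>t. t\<^sup>2) ` ?P) = card ?P" by (rule card_image) (auto simp: inj_on_def)
  have neg: "card (uminus ` ?P) = card ?P" by (rule card_image) (auto simp: inj_on_def)
  have "A = (A \<inter> {0}) \<union> (?P \<union> uminus ` ?P)"
  proof
    show "A \<subseteq> (A \<inter> {0}) \<union> (?P \<union> uminus ` ?P)"
    proof
      fix t assume t: "t \<in> A"
      consider "t = 0" | "t > 0" | "- t > 0" by linarith
      then show "t \<in> (A \<inter> {0}) \<union> (?P \<union> uminus ` ?P)"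
        using t assms(2)[OF t] by cases (auto simp: image_iff intro: bexI[of _ "- t"])
    qed
  qed (use assms(2) in auto)
  moreover have "card ((A \<inter> {0}) \<union> (?P \<union> uminus ` ?P)) = card (A \<inter> {0}) + (card ?P + card (uminus ` ?P))"
    using assms(1) by (subst card_Un_disjoint; (subst card_Un_disjoint)?) auto
  ultimately show ?thesis using sq neg by simp
qed

text \<open>All covering cosines lie between \<open>0\<close> and \<open>1\<close>, so the supremum and the infima behind
  \<^const>\<open>max_covering_cos\<close> are taken over bounded sets and can be compared with their members.\<close>
lemma covering_point_exists:
  fixes C :: "(real ^ 'n) set"
  assumes C: "C \<in> kk_designs k N" and s: "max_covering_cos TYPE('n) k N < s"
  shows "\<exists>x. norm x = 1 \<and> (\<forall>y\<in>C. \<bar>x \<bullet> y\<bar> < s)"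
proof -
  let ?M = "\<lambda>(C :: (real ^ 'n) set) x. Max ((\<lambda>y. x \<bullet> y) ` (C \<union> uminus ` C))"
  have ne: "sphere (0 :: real ^ 'n) 1 \<noteq> {}" by simp
  have code: "finite D" "D \<noteq> {}" "D \<subseteq> sphere 0 1" if "D \<in> kk_designs k N" for D :: "(real ^ 'n) set"
    using that unfolding kk_designs_def kk_design_def spherical_code_def by auto
  have abs: "\<bar>x \<bullet> y\<bar> \<le> ?M D x" if D: "D \<in> kk_designs k N" and y: "y \<in> D" for D x y
  proof -
    have "x \<bullet> z \<le> ?M D x" if "z \<in> D \<union> uminus ` D" for z
      using that code(1)[OF D] by (intro Max_ge finite_imageI imageI) auto
    from this[of y] this[of "- y"] y show ?thesis by simp
  qed
  have nonneg: "0 \<le> ?M D x" if D: "D \<in> kk_designs k N" for D x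
    using abs[OF D] code(2)[OF D] by (meson abs_ge_zero all_not_in_conv order_trans)
  have bdd: "bdd_below (?M D ` sphere 0 1)" if "D \<in> kk_designs k N" for D
    using nonneg[OF that] by (auto intro!: bdd_belowI[of _ 0])
  have le1: "covering_cos D \<le> 1" if D: "D \<in> kk_designs k N" for D :: "(real ^ 'n) set"
  proof -
    obtain x :: "real ^ 'n" where x: "x \<in> sphere 0 1" using ne by blast
    have "?M D x \<le> 1"
    proof (subst Max_le_iff)
      show "\<forall>a\<in>(\<lambda>y. x \<bullet> y) ` (D \<union> uminus ` D). a \<le> 1"
      proof
        fix a assume "a \<in> (\<lambda>y. x \<bullet> y) ` (D \<union> uminus ` D)"
        then have "\<exists>y\<in>D. a = x \<bullet> y \<or> a = - (x \<bullet> y)" by auto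
        then obtain y where y: "a = x \<bullet> y \<or> a = - (x \<bullet> y)" "y \<in> D" by blast
        then have "norm y = 1" using code(3)[OF D] by auto
        then show "a \<le> 1" using Cauchy_Schwarz_ineq2[of x y] x y(1) by auto
      qed
    qed (use code[OF D] in auto)
    moreover have "covering_cos D \<le> ?M D x"
      unfolding covering_cos_def using bdd[OF D] x by (rule cINF_lower)
    ultimately show ?thesis by simp
  qed
  have "covering_cos C \<le> max_covering_cos TYPE('n) k N"
    unfolding max_covering_cos_def
    by (rule cSUP_upper[OF C]) (auto intro!: bdd_aboveI[of _ 1] le1)
  then have "covering_cos C < s" using s by simp
  then obtain x where x: "x \<in> sphere 0 1" "?M C x < s"
    unfolding covering_cos_def using cINF_less_iff[OF ne bdd[OF C]] by blast
  then show ?thesis using abs[OF C] by (intro exI[of _ x]) (auto intro: le_less_trans)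
qed

theorem theorem4p4:
  fixes g h :: "real \<Rightarrow> ereal" and k N :: nat and s :: real and C :: "(real ^ 'n) set"
  assumes "CARD('n) \<ge> 2" and "k \<ge> 1" and "N \<ge> 1"
    and "\<And>t. t \<in> {-1..1} \<Longrightarrow> h t = g (t\<^sup>2)"
    and "\<And>u. u \<in> {0..<1} \<Longrightarrow> \<bar>g u\<bar> \<noteq> \<infinity>" and "g 1 \<noteq> -\<infinity>"
    and "continuous_on {0..<1} g"
    and "(g \<longlongrightarrow> g 1) (at_left 1)"
    and "\<And>j u. j \<le> k \<Longrightarrow> u \<in> {0<..<1} \<Longrightarrow>
           (deriv ^^ j) (\<lambda>v. real_of_ereal (g v)) differentiable (at u)"
    and "kk_design k C" and "card C = N"
    and "max_covering_cos TYPE('n) k N < s" and "s < 1"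
    and "\<And>u. u \<in> {0<..<s\<^sup>2} \<Longrightarrow> (deriv ^^ (k + 1)) (\<lambda>v. real_of_ereal (g v)) u \<ge> 0"
  shows "min_potential h C \<le> maxmin_potential TYPE('n) h k N \<and>
         maxmin_potential TYPE('n) h k N
           \<le> ereal (real N) * (\<Sum>i=0..k + 1. ereal (quad_weight CARD('n) k s i) * h (node CARD('n) k s i))"
proof
  let ?n = "CARD('n)"
  have C: "C \<in> kk_designs k N" using assms(10,11) unfolding kk_designs_def by simp
  then show "min_potential h C \<le> maxmin_potential TYPE('n) h k N"
    unfolding maxmin_potential_def by (rule SUP_upper)
  define \<phi> where "\<phi> v = real_of_ereal (g v)" for v
  show "maxmin_potential TYPE('n) h k N
      \<le> ereal (real N) * (\<Sum>i=0..k + 1. ereal (quad_weight ?n k s i) * h (node ?n k s i))"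
    unfolding maxmin_potential_def
  proof (rule SUP_least)
    fix D :: "(real ^ 'n) set" assume D: "D \<in> kk_designs k N"
    then have design: "kk_design k D" and card: "card D = N" unfolding kk_designs_def by auto
    then have code: "finite D" "D \<noteq> {}" unfolding kk_design_def spherical_code_def by auto
    obtain x where x: "norm x = 1" "\<And>y. y \<in> D \<Longrightarrow> \<bar>x \<bullet> y\<bar> < s"
      using covering_point_exists[OF D assms(12)] by blast
    have s: "0 < s" using x(2) code(2) by (meson abs_ge_zero all_not_in_conv le_less_trans)
    have s2: "0 < s\<^sup>2" "s\<^sup>2 < 1" using s assms(13) by (auto simp: power_less_one_iff)
    note q = q_poly_roots[OF assms(1) design x]
    define A where "A = {t. poly (q_poly ?n k s) t = 0}"
    have finA: "finite A" unfolding A_def using q(1) by (intro poly_roots_finite) (simp add: is_q_poly_def)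
    have A: "card A = k" "A \<subseteq> {-s<..<s}" "\<And>t. t \<in> A \<Longrightarrow> - t \<in> A"
      using q unfolding A_def by auto
    note nodes = node_values[OF q(2,3) finA[unfolded A_def] s, folded A_def]
    have sq_less: "t\<^sup>2 < s\<^sup>2" if "\<bar>t\<bar> < s" for t :: real
      using power_strict_mono[OF that, of 2] by simp
    define E where "E = A \<inter> {0}"
    define D2 where "D2 = (\<lambda>t. t\<^sup>2) ` (A \<inter> {0<..})"
    \<comment> \<open>In \<open>u = t\<^sup>2\<close>: simple contact at \<open>s\<^sup>2\<close> and, if it is a node, at \<open>0\<close>; double contact at
      the squares of the positive nodes.\<close>
    have "\<exists>G. degree G \<le> k \<and> (\<forall>u\<in>insert (s\<^sup>2) (E \<union> D2). poly G u = (deriv ^^ 0) \<phi> u) \<and>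
             (\<forall>u\<in>{0..s\<^sup>2}. (deriv ^^ 0) \<phi> u \<le> poly G u)"
    proof (rule hermite_interpolant_upper_bound[where F = "\<lambda>j. (deriv ^^ j) \<phi>"])
      show "continuous_on {0..s\<^sup>2} ((deriv ^^ 0) \<phi>)"
      proof -
        have "continuous_on {0..<1} (real_of_ereal \<circ> g)"
          using assms(5,7) continuous_on_iff_real[of "{0..<1}" g] by blast
        then show ?thesis
          using s2 by (auto simp: \<phi>_def[abs_def] o_def intro: continuous_on_subset)
      qed
      show "((deriv ^^ j) \<phi> has_real_derivative (deriv ^^ Suc j) \<phi> u) (at u)"
        if "j \<le> k" "u \<in> {0<..<s\<^sup>2}" for j u
        using assms(9)[of j u] that s2 DERIV_deriv_iff_real_differentiable[of "(deriv ^^ j) \<phi>" u]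
        by (simp add: \<phi>_def[abs_def])
      show "(deriv ^^ Suc k) \<phi> u \<ge> 0" if "u \<in> {0<..<s\<^sup>2}" for u
        using assms(14)[OF that] by (simp add: \<phi>_def[abs_def])
      show "D2 \<subseteq> {0<..<s\<^sup>2}"
        unfolding D2_def using subsetD[OF A(2)] by (auto intro!: sq_less)
      show "k = card E + 2 * card D2"
        using symmetric_set_card[OF finA A(3)] A(1) unfolding E_def D2_def by simp
    qed (use s2 finA in \<open>auto simp: E_def D2_def\<close>)
    then obtain G where G: "degree G \<le> k" "\<forall>u\<in>insert (s\<^sup>2) (E \<union> D2). poly G u = \<phi> u"
      "\<forall>u\<in>{0..s\<^sup>2}. \<phi> u \<le> poly G u" by (elim exE conjE) (rule that, simp_all)
    define f where "f = pcompose G [:0, 0, 1:]"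
    have f: "poly f t = poly G (t\<^sup>2)" for t
      unfolding f_def by (simp add: poly_pcompose power2_eq_square)
    have degf: "degree f \<le> 2 * k + 1" unfolding f_def using G(1) by (simp add: degree_pcompose)
    have h: "h t = ereal (\<phi> (t\<^sup>2))" if "\<bar>t\<bar> \<le> s" for t
    proof -
      have "t\<^sup>2 \<le> s\<^sup>2" using that by (simp add: abs_le_square_iff[symmetric])
      then have "t\<^sup>2 \<in> {0..<1}" using s2 by auto
      then show ?thesis
        using assms(4)[of t] assms(5)[of "t\<^sup>2"] that assms(13) by (auto simp: \<phi>_def ereal_real abs_le_iff)
    qed
    have hf: "h (node ?n k s i) = ereal (poly f (node ?n k s i))" if i: "i \<in> {0..k + 1}" for i
    proof -
      consider "i = 0" | "i \<in> {1..k}" | "i = k + 1" using i by force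
      then show ?thesis
      proof cases
        case 2
        define t where "t = node ?n k s i"
        have t: "t \<in> A" unfolding t_def using 2 nodes(1) by blast
        have "t\<^sup>2 \<in> E \<union> D2"
        proof -
          consider "t = 0" | "t > 0" | "- t > 0" by linarith
          then show ?thesis
            using t A(3)[OF t] unfolding E_def D2_def
            by cases (auto simp: image_iff intro: bexI[of _ "- t"])
        qed
        then show ?thesis
          using h[of t] G(2) A(2) t unfolding t_def[symmetric] f by (auto simp: abs_le_iff)
      qed (use h[of s] h[of "- s"] G(2) s in \<open>simp_all add: nodes(3) nodes(4)[simplified] f\<close>)
    qed
    have "min_potential h D \<le> potential h x D"
      unfolding min_potential_def by (rule INF_lower) (use x(1) in simp)
    also have "\<dots> = (\<Sum>y\<in>D. ereal (\<phi> ((x \<bullet> y)\<^sup>2)))"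
      unfolding potential_def using x(2) by (intro sum.cong refl h) (auto intro: less_imp_le)
    also have "\<dots> \<le> (\<Sum>y\<in>D. ereal (poly f (x \<bullet> y)))"
      unfolding f using x(2) by (intro sum_mono) (auto intro!: G(3)[rule_format] less_imp_le[OF sq_less])
    also have "\<dots> = ereal (\<Sum>y\<in>D. poly f (x \<bullet> y))" by simp
    also have "(\<Sum>y\<in>D. poly f (x \<bullet> y)) = N * geg_int ?n f"
    proof -
      have "2 * (\<Sum>y\<in>D. poly f (x \<bullet> y)) = (\<Sum>y\<in>D. poly f (x \<bullet> y) + poly f (- (x \<bullet> y)))"
        by (simp add: f sum_distrib_left)
      then show ?thesis using design_cubature[OF assms(1) design degf x(1)] card by simp
    qed
    also have "geg_int ?n f = (\<Sum>i=0..k + 1. quad_weight ?n k s i * poly f (node ?n k s i))"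
      by (rule quadrature[OF assms(1) q(1-3) s degf])
    also have "ereal (N * \<dots>) = ereal N * (\<Sum>i=0..k + 1. ereal (quad_weight ?n k s i) * h (node ?n k s i))"
      using hf by (simp del: sum.atLeast_Suc_atMost sum.atLeast0_atMost_Suc)
    finally show "min_potential h D \<le> ereal (real N) *
      (\<Sum>i=0..k + 1. ereal (quad_weight ?n k s i) * h (node ?n k s i))" .
  qed
qed

end
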